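(* Let $W$ be an $r \times c$ storage area with $r \le c$ whose open side is its bottom (front) row. In the online setting with lookahead $1$, for every number of loads $n \le rc$ (any storage density), there is a strategy that, for every arrival sequence $A$ and departure sequence $D=(1,\dots,n)$, stores all loads in the order $A$ and then retrieves them in the order $D$ using a total number of actions that is at most $1.125$ times the minimum possible total number of actions for that instance.
   Context: Storage area: a rectangular grid $W$ with $r$ rows and $c$ columns; the bottom row (front row) is the only side through which loads enter and leave. There are $n \le rc$ loads with distinct labels $1,\dots,n$, each occupying exactly one cell; no two loads share a cell. The density is $n/(rc)$. A load moves only along paths of horizontally/vertically adjacent cells (moves up, down, left, right) that are currently empty (apart from the load's own starting cell). Actions: (Storage) an arriving load is placed in an empty cell $v$ via a path from any cell of the front row to $v$. (Retrieval) a load is removed via a path from its current cell to any cell of the front row. (Relocation) a load is moved inside $W$ from its current cell to an empty cell $v$ via a path, where $v$ and the original cell must be accessible from the front row. Loads arrive one at a time in the order $A=(a_1,\dots,a_n)$ (a permutation of $\{1,\dots,n\}$), each being stored before the next arrives; after all are stored, they are retrieved in the order of the departure sequence $D$, fixed to be $(1,\dots,n)$ by relabeling. The total number of actions counts all storage, retrieval and relocation actions; the minimum for an instance is taken over all valid action sequences (with full knowledge of $A$ and $D$). Online setting with lookahead $\ell$: when a load $a_t$ is to be stored, only the next $\ell$ arriving loads $a_t,\dots,a_{t+\ell-1}$ (as far as they exist) are known, besides the past arrivals; the departure sequence $D$ is fully known (so $n$ and the position of each known load in $D$ are known). With lookahead $1$, only the load $a_t$ currently being stored is known. *)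

theory Defs
  imports Complex_Main
begin

text \<open>Cells are pairs (row, column); row 0 is the front row.\<close>

type_synonym cell = "nat \<times> nat"
type_synonym load = nat

definition grid :: "nat \<Rightarrow> nat \<Rightarrow> cell set" where
  "grid r c = {..<r} \<times> {..<c}"

definition front_row :: "nat \<Rightarrow> nat \<Rightarrow> cell set" where
  "front_row r c = {(i, j) \<in> grid r c. i = 0}"

fun adjacent :: "cell \<Rightarrow> cell \<Rightarrow> bool" where
  "adjacent (i, j) (i', j') \<longleftrightarrow>
     (i = i' \<and> (j' = Suc j \<or> j = Suc j')) \<or> (j = j' \<and> (i' = Suc i \<or> i = Suc i'))"

definition path_in :: "cell set \<Rightarrow> cell \<Rightarrow> cell list \<Rightarrow> cell \<Rightarrow> bool" where
  "path_in S u p v \<longleftrightarrow>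
     p \<noteq> [] \<and> hd p = u \<and> last p = v \<and> set p \<subseteq> S \<and> successively adjacent p"

text \<open>A configuration maps each load currently in storage to its cell. That no two loads share
  a cell is an invariant of legal runs, since loads are only ever put into empty cells.\<close>

type_synonym config = "load \<rightharpoonup> cell"

definition empty_cells :: "nat \<Rightarrow> nat \<Rightarrow> config \<Rightarrow> cell set" where
  "empty_cells r c \<sigma> = grid r c - ran \<sigma>"

text \<open>The cell itself may be occupied; all other cells of the path must be empty.\<close>

definition accessible :: "nat \<Rightarrow> nat \<Rightarrow> config \<Rightarrow> cell \<Rightarrow> bool" where
  "accessible r c \<sigma> v \<longleftrightarrow>
     (\<exists>f\<in>front_row r c. \<exists>p. path_in (insert v (empty_cells r c \<sigma>)) f p v)"

datatype action = Store load cell | Retrieve load | Relocate load cell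

fun legal :: "nat \<Rightarrow> nat \<Rightarrow> config \<Rightarrow> action \<Rightarrow> bool" where
  "legal r c \<sigma> (Store x v) \<longleftrightarrow>
     \<sigma> x = None \<and> v \<in> empty_cells r c \<sigma> \<and> accessible r c \<sigma> v"
| "legal r c \<sigma> (Retrieve x) \<longleftrightarrow>
     (\<exists>u. \<sigma> x = Some u \<and> accessible r c \<sigma> u)"
| "legal r c \<sigma> (Relocate x v) \<longleftrightarrow>
     (\<exists>u. \<sigma> x = Some u \<and> v \<in> empty_cells r c \<sigma> \<and>
        accessible r c \<sigma> u \<and> accessible r c \<sigma> v \<and>
        (\<exists>p. path_in (insert u (empty_cells r c \<sigma>)) u p v))"

fun perform :: "action \<Rightarrow> config \<Rightarrow> config" where
  "perform (Store x v) \<sigma> = \<sigma>(x \<mapsto> v)"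
| "perform (Retrieve x) \<sigma> = \<sigma>(x := None)"
| "perform (Relocate x v) \<sigma> = \<sigma>(x \<mapsto> v)"

fun legal_run :: "nat \<Rightarrow> nat \<Rightarrow> config \<Rightarrow> action list \<Rightarrow> bool" where
  "legal_run r c \<sigma> [] \<longleftrightarrow> True"
| "legal_run r c \<sigma> (a # as) \<longleftrightarrow> legal r c \<sigma> a \<and> legal_run r c (perform a \<sigma>) as"

definition stored_loads :: "action list \<Rightarrow> load list" where
  "stored_loads as = concat (map (\<lambda>a. case a of Store x v \<Rightarrow> [x] | _ \<Rightarrow> []) as)"

definition retrieved_loads :: "action list \<Rightarrow> load list" where
  "retrieved_loads as = concat (map (\<lambda>a. case a of Retrieve x \<Rightarrow> [x] | _ \<Rightarrow> []) as)"

text \<open>A plan consists of a storage phase followed by a retrieval phase; relocations may occur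
  in both.\<close>

definition valid_plan ::
  "nat \<Rightarrow> nat \<Rightarrow> load list \<Rightarrow> load list \<Rightarrow> action list \<Rightarrow> bool" where
  "valid_plan r c A D as \<longleftrightarrow>
     legal_run r c Map.empty as \<and>
     (\<exists>ss rs. as = ss @ rs \<and>
        stored_loads ss = A \<and> retrieved_loads ss = [] \<and>
        stored_loads rs = [] \<and> retrieved_loads rs = D)"

definition min_actions :: "nat \<Rightarrow> nat \<Rightarrow> load list \<Rightarrow> load list \<Rightarrow> nat" where
  "min_actions r c A D = (LEAST k. \<exists>as. valid_plan r c A D as \<and> length as = k)"

text \<open>An online strategy is given the current time step and the loads known at that step, and
  returns the next block of actions. In step t (counted from 0, with t less than the number of
  loads) the load A ! t is stored, and with lookahead l the first t + l arrivals are known;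
  the last step is the retrieval phase, where all of A is known. A strategy
  need not be told the departure sequence or the number of loads when these are fixed before
  the strategy is chosen.\<close>

type_synonym strategy = "nat \<Rightarrow> load list \<Rightarrow> action list"

definition online_block :: "nat \<Rightarrow> strategy \<Rightarrow> load list \<Rightarrow> nat \<Rightarrow> action list" where
  "online_block l S A t = S t (take (t + l) A)"

definition online_actions :: "nat \<Rightarrow> strategy \<Rightarrow> load list \<Rightarrow> action list" where
  "online_actions l S A = concat (map (online_block l S A) [0..<Suc (length A)])"

definition serves_online ::
  "nat \<Rightarrow> nat \<Rightarrow> nat \<Rightarrow> strategy \<Rightarrow> load list \<Rightarrow> load list \<Rightarrow> bool" where
  "serves_online r c l S A D \<longleftrightarrow>
     valid_plan r c A D (online_actions l S A) \<and>
     (\<forall>t<length A. stored_loads (online_block l S A t) = [A ! t] \<and>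
                   retrieved_loads (online_block l S A t) = [])"

end

theory Submission
  imports Defs
begin

text \<open>Every plan needs at least \<open>2 n\<close> actions, so it suffices to get by with \<open>n / 4\<close> relocations.
  For \<open>c \<ge> 3\<close> let \<open>k = n div c\<close>. The loads \<open>1, \<dots>, k + 2 r\<close> share the columns 0, 1, 2; each later block
  of \<open>r\<close> consecutive departures owns one of the columns \<open>3, \<dots>, c - 1\<close> and is retrieved through the
  column to its left, which is empty by then. Among the first three columns, column 1 is the one
  to be emptied from front to back: a load \<open>x \<le> k\<close> belongs into its exact cell \<open>(x - 1, 1)\<close>, which
  is reached through column 0 as long as that is free, while all other cells are filled from the
  back. Every relocation, during storage or retrieval, can be charged to a different one of the
  loads \<open>2, \<dots>, k\<close>, and \<open>4 (k - 1) \<le> k\<^sup>2 \<le> k c \<le> n\<close> since \<open>k \<le> r \<le> c\<close>.\<close>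

section \<open>Paths, plans and online strategies\<close>

lemma path_in_single: "u \<in> S \<Longrightarrow> path_in S u [u] u"
  by (simp add: path_in_def)

lemma path_in_Cons:
  "path_in S v p w \<Longrightarrow> u \<in> S \<Longrightarrow> adjacent u v \<Longrightarrow> path_in S u (u # p) w"
  by (cases p) (auto simp: path_in_def)

lemma path_in_snoc:
  "path_in S u p v \<Longrightarrow> w \<in> S \<Longrightarrow> adjacent v w \<Longrightarrow> path_in S u (p @ [w]) w"
  by (auto simp: path_in_def successively_append_iff)

lemma column_path_up:
  assumes "a \<le> b" "\<And>i. a \<le> i \<Longrightarrow> i \<le> b \<Longrightarrow> (i, j) \<in> S"
  shows "\<exists>p. path_in S (a, j) p (b, j)"
  using assms
proof (induction b rule: dec_induct)
  case base
  then show ?case using path_in_single by blast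
next
  case (step b)
  then obtain p where "path_in S (a, j) p (b, j)" by auto
  then have "path_in S (a, j) (p @ [(Suc b, j)]) (Suc b, j)"
    using step.prems[of "Suc b"] step.hyps by (intro path_in_snoc) auto
  then show ?case by blast
qed

lemma column_path_down:
  assumes "a \<le> b" "\<And>i. a \<le> i \<Longrightarrow> i \<le> b \<Longrightarrow> (i, j) \<in> S"
  shows "\<exists>p. path_in S (b, j) p (a, j)"
  using assms
proof (induction b rule: dec_induct)
  case base
  then show ?case using path_in_single by blast
next
  case (step b)
  then obtain p where "path_in S (b, j) p (a, j)" by auto
  then have "path_in S (Suc b, j) ((Suc b, j) # p) (a, j)"
    using step.prems[of "Suc b"] step.hyps by (intro path_in_Cons) auto
  then show ?case by blast
qed

lemma accessible_own_column:
  assumes "i < r" "j < c" "\<And>i'. i' < i \<Longrightarrow> (i', j) \<notin> ran \<sigma>"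
  shows "accessible r c \<sigma> (i, j)"
proof -
  have "\<exists>p. path_in (insert (i, j) (empty_cells r c \<sigma>)) (0, j) p (i, j)"
    using assms by (intro column_path_up) (auto simp: empty_cells_def grid_def le_less)
  moreover have "(0, j) \<in> front_row r c"
    using assms by (auto simp: front_row_def grid_def)
  ultimately show ?thesis unfolding accessible_def by blast
qed

lemma accessible_side_column:
  assumes "i < r" "j' < c" "adjacent (i, j') (i, j)" "\<And>i'. i' \<le> i \<Longrightarrow> (i', j') \<notin> ran \<sigma>"
  shows "accessible r c \<sigma> (i, j)"
proof -
  have "\<exists>p. path_in (insert (i, j) (empty_cells r c \<sigma>)) (0, j') p (i, j')"
    using assms by (intro column_path_up) (auto simp: empty_cells_def grid_def)
  then obtain p where "path_in (insert (i, j) (empty_cells r c \<sigma>)) (0, j') p (i, j')" by blast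
  then have "path_in (insert (i, j) (empty_cells r c \<sigma>)) (0, j') (p @ [(i, j)]) (i, j)"
    using assms(3) by (intro path_in_snoc) auto
  moreover have "(0, j') \<in> front_row r c"
    using assms by (auto simp: front_row_def grid_def)
  ultimately show ?thesis unfolding accessible_def by blast
qed

section \<open>Runs of actions and the lower bound of two actions per load\<close>

lemma legal_run_append:
  "legal_run r c \<sigma> (as @ bs) \<longleftrightarrow> legal_run r c \<sigma> as \<and> legal_run r c (fold perform as \<sigma>) bs"
  by (induction as arbitrary: \<sigma>) auto

lemma stored_loads_simps [simp]:
  "stored_loads [] = []"
  "stored_loads (Store x v # as) = x # stored_loads as"
  "stored_loads (Retrieve x # as) = stored_loads as"
  "stored_loads (Relocate x v # as) = stored_loads as"
  "stored_loads (as @ bs) = stored_loads as @ stored_loads bs"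
  by (simp_all add: stored_loads_def)

lemma retrieved_loads_simps [simp]:
  "retrieved_loads [] = []"
  "retrieved_loads (Store x v # as) = retrieved_loads as"
  "retrieved_loads (Retrieve x # as) = x # retrieved_loads as"
  "retrieved_loads (Relocate x v # as) = retrieved_loads as"
  "retrieved_loads (as @ bs) = retrieved_loads as @ retrieved_loads bs"
  by (simp_all add: retrieved_loads_def)

lemma length_ge_stored_plus_retrieved:
  "length (stored_loads as) + length (retrieved_loads as) \<le> length as"
proof (induction as)
  case (Cons a as)
  then show ?case by (cases a) auto
qed simp

lemma valid_plan_length:
  "valid_plan r c A D as \<Longrightarrow> length A + length D \<le> length as"
  using length_ge_stored_plus_retrieved[of as] unfolding valid_plan_def by auto

text \<open>The given plan shows that the \<open>LEAST\<close> in \<open>min_actions\<close> ranges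
  over a nonempty set; hence the minimum is attained by a plan to which
  \<open>valid_plan_length\<close> applies.\<close>

lemma min_actions_ge:
  assumes "valid_plan r c A D as"
  shows "length A + length D \<le> min_actions r c A D"
proof -
  have "\<exists>bs. valid_plan r c A D bs \<and> length bs = min_actions r c A D"
    unfolding min_actions_def by (rule LeastI_ex) (use assms in blast)
  then show ?thesis using valid_plan_length by metis
qed

text \<open>Arrivals are listed latest first, so that recursion peels off the latest one.\<close>

primrec history :: "(load list \<Rightarrow> action list \<Rightarrow> load \<Rightarrow> action list) \<Rightarrow> load list \<Rightarrow> action list" where
  "history f [] = []"
| "history f (x # ys) = history f ys @ f (rev ys) (history f ys) x"

text \<open>Reduces the construction of a strategy to an invariant \<open>good\<close>:
  \<open>step\<close> extends a good run by a block depending only on past actions and the current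
  arrival, \<open>final\<close> empties the storage. As the blocks come from fixed choice functions,
  all earlier actions can be recomputed from the known prefix.\<close>

lemma online_strategy_from_steps:
  fixes good :: "load list \<Rightarrow> action list \<Rightarrow> bool"
  assumes init: "good [] []"
    and step: "\<And>xs as x. good xs as \<Longrightarrow> distinct (xs @ [x]) \<Longrightarrow> set (xs @ [x]) \<subseteq> N \<Longrightarrow>
      \<exists>bs. stored_loads bs = [x] \<and> retrieved_loads bs = [] \<and> good (xs @ [x]) (as @ bs)"
    and final: "\<And>A as. good A as \<Longrightarrow> distinct A \<Longrightarrow> set A = N \<Longrightarrow> \<exists>rs. stored_loads rs = [] \<and>
      retrieved_loads rs = D \<and> legal_run r c Map.empty (as @ rs) \<and> length (as @ rs) \<le> b"
  shows "\<exists>S. \<forall>A. distinct A \<and> set A = N \<longrightarrow>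
    serves_online r c 1 S A D \<and> length (online_actions 1 S A) \<le> b"
proof -
  obtain f where f: "\<And>xs as x. good xs as \<Longrightarrow> distinct (xs @ [x]) \<Longrightarrow> set (xs @ [x]) \<subseteq> N \<Longrightarrow>
      stored_loads (f xs as x) = [x] \<and> retrieved_loads (f xs as x) = [] \<and>
      good (xs @ [x]) (as @ f xs as x)"
    using step by metis
  obtain g where g: "\<And>A as. good A as \<Longrightarrow> distinct A \<Longrightarrow> set A = N \<Longrightarrow>
      stored_loads (g A as) = [] \<and> retrieved_loads (g A as) = D \<and>
      legal_run r c Map.empty (as @ g A as) \<and> length (as @ g A as) \<le> b"
    using final by metis
  define H where "H xs = history f (rev xs)" for xs
  have H_Nil: "H [] = []" and H_snoc: "H (xs @ [x]) = H xs @ f xs (H xs) x" for xs x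
    by (simp_all add: H_def)
  \<comment> \<open>With lookahead 1 the list known in step \<open>t < card N\<close> is
    \<open>take (Suc t) A\<close>, so its last entry is the load to be stored. In step
    \<open>card N\<close> the list is all of \<open>A\<close> and the retrieval phase
    starts.\<close>
  define S where "S t xs = (if t < card N then f (butlast xs) (H (butlast xs)) (last xs) else g xs (H xs))"
    for t xs
  have good: "good xs (H xs) \<and> stored_loads (H xs) = xs \<and> retrieved_loads (H xs) = []"
    if "distinct xs" "set xs \<subseteq> N" for xs
    using that
  proof (induction xs rule: rev_induct)
    case Nil
    then show ?case by (simp add: H_Nil init)
  next
    case (snoc x xs)
    then show ?case using f[of xs "H xs" x] by (auto simp: H_snoc)
  qed
  have "serves_online r c 1 S A D \<and> length (online_actions 1 S A) \<le> b"
    if A: "distinct A" "set A = N" for A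
  proof -
    have len: "length A = card N" using A distinct_card by metis
    have block: "online_block 1 S A t = f (take t A) (H (take t A)) (A ! t)" if "t < length A" for t
      using that len by (simp add: online_block_def S_def take_Suc_conv_app_nth)
    have pre: "concat (map (online_block 1 S A) [0..<t]) = H (take t A)" if "t \<le> length A" for t
      using that
    proof (induction t)
      case (Suc t)
      then show ?case using block[of t] by (simp add: take_Suc_conv_app_nth H_snoc)
    qed (simp add: H_Nil)
    have acts: "online_actions 1 S A = H A @ g A (H A)"
      using pre[of "length A"] by (simp add: online_actions_def online_block_def S_def len)
    have goodA: "good A (H A)" "stored_loads (H A) = A" "retrieved_loads (H A) = []"
      using good[of A] A by auto
    have "stored_loads (online_block 1 S A t) = [A ! t] \<and> retrieved_loads (online_block 1 S A t) = []"
      if "t < length A" for t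
    proof -
      have "distinct (take t A @ [A ! t])" "set (take t A @ [A ! t]) \<subseteq> N"
        using that A set_take_subset[of "Suc t" A]
        by (simp_all flip: take_Suc_conv_app_nth)
      then show ?thesis
        using f[of "take t A" "H (take t A)" "A ! t"] good[of "take t A"] block[OF that] by auto
    qed
    moreover have "valid_plan r c A D (H A @ g A (H A))"
      unfolding valid_plan_def using g[OF goodA(1) A] goodA by blast
    ultimately show ?thesis
      using g[OF goodA(1) A] unfolding serves_online_def acts by blast
  qed
  then show ?thesis by blast
qed

section \<open>Storage areas with at least three columns\<close>

locale storage_area =
  fixes r c n :: nat
  assumes r_le_c: "r \<le> c" and n_le: "n \<le> r * c" and c_ge: "3 \<le> c"
begin

section \<open>Assignment of loads to columns\<close>

definition k :: nat where "k = n div c"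

text \<open>The value 0 stands for the three shared columns together. Beyond
  \<open>k + 2 * r\<close> the quotient is at least 2 (for \<open>r > 0\<close>), so after
  \<open>Suc\<close> the blocks of length \<open>r\<close> carry the column numbers 3, 4 and so
  on.\<close>

definition home :: "load \<Rightarrow> nat" where
  "home x = (if x \<le> k + 2 * r then 0 else Suc ((x - k - 1) div r))"

lemma r_pos: "x \<in> {1..n} \<Longrightarrow> 0 < r"
  using n_le by (auto intro: Nat.gr0I)

lemma k_le_r: "k \<le> r"
  unfolding k_def using div_le_mono[OF n_le, of c] c_ge by auto

text \<open>With \<open>k\<close> cells of column 1 set aside, the other loads have to fit into
  \<open>c - 1\<close> columns. Below full density \<open>k < r\<close>, and the remainder
  \<open>n mod c \<le> c - 1\<close> takes at most one more row of those columns.\<close>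

lemma n_minus_k_le: "n - k \<le> r * (c - 1)"
proof (cases "n = r * c")
  case True
  then have "k = r" unfolding k_def using c_ge by simp
  then show ?thesis using True c_ge by (cases c) (auto simp: algebra_simps)
next
  case False
  then have "n < r * c" using n_le by simp
  then have "k < r" by (simp add: k_def less_mult_imp_div_less)
  have "n = k * c + n mod c" by (simp add: k_def)
  moreover have "n mod c < c" using c_ge by simp
  moreover have "k * c = k * (c - 1) + k" using c_ge by (cases c) auto
  ultimately have "n - k \<le> k * (c - 1) + (c - 1)" by linarith
  also have "\<dots> = Suc k * (c - 1)" by simp
  also have "\<dots> \<le> r * (c - 1)" using \<open>k < r\<close> by (intro mult_le_mono1) simp
  finally show ?thesis .
qed

lemma home_less: assumes "x \<in> {1..n}" shows "home x < c"
proof (cases "home x = 0")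
  case True
  then show ?thesis using c_ge by simp
next
  case False
  then have x: "k + 2 * r < x" by (auto simp: home_def split: if_splits)
  then have "x - k - 1 < (c - 1) * r"
    using assms n_minus_k_le by (auto simp: mult.commute)
  then have "(x - k - 1) div r < c - 1" by (simp add: less_mult_imp_div_less)
  then show ?thesis using x by (simp add: home_def)
qed

lemma home_ge_3: assumes "0 < r" "home x \<noteq> 0" shows "3 \<le> home x"
proof -
  have x: "k + 2 * r < x" using assms by (auto simp: home_def split: if_splits)
  then have "2 * r div r \<le> (x - k - 1) div r" by (intro div_le_mono) auto
  then show ?thesis using x assms(1) by (simp add: home_def)
qed

lemma home_eq_0: "home x = 0 \<longleftrightarrow> x \<le> k + 2 * r"
  by (simp add: home_def)

lemma home_mono: "x \<le> y \<Longrightarrow> home x \<le> home y"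
  by (auto simp: home_def intro: div_le_mono)

lemma card_home:
  assumes "0 < r" "0 < j" shows "finite {x. home x = j}" "card {x. home x = j} \<le> r"
proof -
  have "{x. home x = j} \<subseteq> {k + (j - 1) * r + 1 ..< k + (j - 1) * r + 1 + r}"
  proof
    fix x assume "x \<in> {x. home x = j}"
    then have x: "k < x" "j - 1 = (x - k - 1) div r"
      using assms by (auto simp: home_def split: if_splits)
    have "(j - 1) * r + (x - k - 1) mod r = x - k - 1" unfolding x(2) by (rule div_mult_mod_eq)
    moreover have "(x - k - 1) mod r < r" using assms by simp
    ultimately show "x \<in> {k + (j - 1) * r + 1 ..< k + (j - 1) * r + 1 + r}"
      using x(1) unfolding atLeastLessThan_iff by linarith
  qed
  then show "finite {x. home x = j}" "card {x. home x = j} \<le> r"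
    using card_mono[of "{k + (j - 1) * r + 1 ..< k + (j - 1) * r + 1 + r}"]
    by (auto intro: finite_subset)
qed

section \<open>The invariant of the storage phase\<close>

text \<open>\<open>R\<close> is the set of occupied cells. A load \<open>x \<le> k\<close> outside its exact cell \<open>(x - 1, 1)\<close> lies in a
  row strictly in front of it, so that whatever blocks the exact cell when \<open>x\<close> leaves can move
  forward into the cell of \<open>x\<close>. Column 1 takes a foreign load only when the cells behind it in
  columns 0 and 1, and column 2 up to its front cell, are full.\<close>

definition fits :: "cell set \<Rightarrow> load \<Rightarrow> nat \<Rightarrow> nat \<Rightarrow> bool" where
  "fits R x i j \<longleftrightarrow> x \<in> {1..n} \<and> i < r \<and> (if home x = 0 then j \<le> 2 else j = home x) \<and>
     (x \<le> k \<longrightarrow> i = x - 1 \<and> j = 1 \<or> i + 2 \<le> x) \<and>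
     (j = 1 \<longrightarrow> i < k \<and> (x = Suc i \<or> 0 < i \<and> Suc i < x \<and>
        (\<forall>i'>i. (i' < r \<longrightarrow> (i', 0) \<in> R) \<and> (i' < k \<longrightarrow> (i', 1) \<in> R)) \<and>
        (\<forall>i'>0. i' < r \<longrightarrow> (i', 2) \<in> R)))"

text \<open>Apart from loads put into their exact cells, the shared columns are filled in a fixed
  order: column 2 except its front cell, then columns 1 and 0 row by row from the back. Hence a free
  cell of column 1 in a row \<open>0 < i < k\<close> can be reached through column 0. Row 0 is
  exempt because \<open>(0, 1)\<close> is kept for load 1 and \<open>(0, 2)\<close> is a
  spare.\<close>

definition back_filled :: "cell set \<Rightarrow> bool" where
  "back_filled R \<longleftrightarrow>
     (\<forall>i i' j. (i, j) \<in> R \<longrightarrow> i < i' \<longrightarrow> i' < r \<longrightarrow> j \<noteq> 1 \<longrightarrow> (i', j) \<in> R) \<and>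
     (\<forall>i i'. (i, 0) \<in> R \<longrightarrow> i \<le> i' \<longrightarrow> 0 < i' \<longrightarrow> i' < k \<longrightarrow> (i', 1) \<in> R) \<and>
     (\<forall>i i'. (i, 0) \<in> R \<longrightarrow> 0 < i' \<longrightarrow> i' < r \<longrightarrow> (i', 2) \<in> R)"

text \<open>The cell \<open>(0, 2)\<close> is kept as a spare for a load whose exact cell is taken by a foreign load
  that cannot usefully be moved. The last clause says that when it is used, no such load is
  still to come.\<close>

definition storing :: "config \<Rightarrow> bool" where
  "storing \<sigma> \<longleftrightarrow> inj_on \<sigma> (dom \<sigma>) \<and> back_filled (ran \<sigma>) \<and>
     (\<forall>x i j. \<sigma> x = Some (i, j) \<longrightarrow> fits (ran \<sigma>) x i j) \<and>
     ((0, 2) \<in> ran \<sigma> \<longrightarrow> (\<forall>x. 1 < x \<longrightarrow> x \<le> k \<longrightarrow> \<sigma> x = None \<longrightarrow> (x - 1, 0) \<in> ran \<sigma>))"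

text \<open>Rows that pay for a relocation of the storage phase: load \<open>Suc i\<close> is in its exact cell and so
  needs no relocation when the storage is emptied. Rows that the occupied part of column 0 has not
  yet reached do not count, so that they can still pay for a later relocation.\<close>

definition settled :: "config \<Rightarrow> nat set" where
  "settled \<sigma> = {i. 0 < i \<and> i < k \<and> \<sigma> (Suc i) = Some (i, 1) \<and>
     ((i, 0) \<in> ran \<sigma> \<or> (Suc i, 0) \<in> ran \<sigma>)}"

lemma finite_settled: "finite (settled \<sigma>)"
  by (rule finite_subset[of _ "{..<k}"]) (auto simp: settled_def)

text \<open>\<open>R\<close> occurs only positively in \<open>fits\<close>, so filling further cells
  spoils no earlier placement.\<close>

lemma fits_mono: "fits R x i j \<Longrightarrow> R \<subseteq> R' \<Longrightarrow> fits R' x i j"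
  unfolding fits_def by (auto split: if_splits)

lemma storing_fits: "storing \<sigma> \<Longrightarrow> \<sigma> x = Some (i, j) \<Longrightarrow> fits (ran \<sigma>) x i j"
  by (simp add: storing_def)

lemma storing_inj: "storing \<sigma> \<Longrightarrow> \<sigma> x = Some p \<Longrightarrow> \<sigma> y = Some p \<Longrightarrow> x = y"
  unfolding storing_def by (metis domI inj_onD)

lemma storing_up:
  "storing \<sigma> \<Longrightarrow> (i', j) \<notin> ran \<sigma> \<Longrightarrow> i \<le> i' \<Longrightarrow> i' < r \<Longrightarrow> j \<noteq> 1 \<Longrightarrow> (i, j) \<notin> ran \<sigma>"
  unfolding storing_def back_filled_def by (cases "i = i'") (auto simp: le_less)

section \<open>Storing a single load\<close>

lemma storing_store:
  assumes "storing \<sigma>" "\<sigma> x = None" "(i, j) \<notin> ran \<sigma>"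
    and "fits (insert (i, j) (ran \<sigma>)) x i j" "back_filled (insert (i, j) (ran \<sigma>))"
    and "(i, j) = (0, 2) \<longrightarrow> (\<forall>y. 1 < y \<longrightarrow> y \<le> k \<longrightarrow> y \<noteq> x \<longrightarrow> \<sigma> y = None \<longrightarrow> (y - 1, 0) \<in> ran \<sigma>)"
  shows "storing (\<sigma>(x \<mapsto> (i, j)))"
proof -
  have "inj_on (\<sigma>(x \<mapsto> (i, j))) (dom (\<sigma>(x \<mapsto> (i, j))))"
    using assms(1,3) by (auto simp: storing_def inj_on_def ran_def)
  then show ?thesis
    using assms fits_mono[OF _ subset_insertI, of "ran \<sigma>" _ _ _ "(i, j)"]
    unfolding storing_def by (auto simp: ran_map_upd)
qed

text \<open>The last clause is the amortised cost: beyond the one storage action, the block is no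
  longer than the growth of \<open>settled\<close>.\<close>

definition store_outcome :: "config \<Rightarrow> load \<Rightarrow> action list \<Rightarrow> bool" where
  "store_outcome \<sigma> x bs \<longleftrightarrow> legal_run r c \<sigma> bs \<and> stored_loads bs = [x] \<and> retrieved_loads bs = [] \<and>
     storing (fold perform bs \<sigma>) \<and> dom (fold perform bs \<sigma>) = insert x (dom \<sigma>) \<and>
     length bs + card (settled \<sigma>) \<le> Suc (card (settled (fold perform bs \<sigma>)))"

text \<open>A storage on its own moves no other load, so no settled row is lost and nothing has to
  be charged.\<close>

lemma single_store:
  assumes "storing \<sigma>" "\<sigma> x = None" "(i, j) \<notin> ran \<sigma>" "j < c" "accessible r c \<sigma> (i, j)"
    and "fits (insert (i, j) (ran \<sigma>)) x i j" "back_filled (insert (i, j) (ran \<sigma>))"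
    and "(i, j) = (0, 2) \<longrightarrow> (\<forall>y. 1 < y \<longrightarrow> y \<le> k \<longrightarrow> y \<noteq> x \<longrightarrow> \<sigma> y = None \<longrightarrow> (y - 1, 0) \<in> ran \<sigma>)"
  shows "store_outcome \<sigma> x [Store x (i, j)]"
proof -
  have "settled \<sigma> \<subseteq> settled (\<sigma>(x \<mapsto> (i, j)))"
    using assms(2) by (auto simp: settled_def ran_map_upd)
  then have "card (settled \<sigma>) \<le> card (settled (\<sigma>(x \<mapsto> (i, j))))"
    by (intro card_mono finite_settled)
  moreover have "i < r" using assms(6) by (simp add: fits_def)
  then have "legal r c \<sigma> (Store x (i, j))"
    using assms(2-5) by (simp add: empty_cells_def grid_def)
  moreover note storing_store[OF assms(1-3,6-8)]
  ultimately show ?thesis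
    by (simp add: store_outcome_def del: legal.simps)
qed

lemma deepest_free_row:
  assumes \<sigma>: "storing \<sigma>" and j: "j \<noteq> 1" and free: "i0 < r" "(i0, j) \<notin> ran \<sigma>"
  shows "\<exists>i\<ge>i0. i < r \<and> (\<forall>i'\<le>i. (i', j) \<notin> ran \<sigma>) \<and> (\<forall>i'>i. i' < r \<longrightarrow> (i', j) \<in> ran \<sigma>)"
proof -
  define i where "i = (GREATEST i. i < r \<and> (i, j) \<notin> ran \<sigma>)"
  have i: "i < r \<and> (i, j) \<notin> ran \<sigma>"
    unfolding i_def by (rule GreatestI_nat[of _ i0 r]) (use free in auto)
  have le: "i' \<le> i" if "i' < r" "(i', j) \<notin> ran \<sigma>" for i'
    using Greatest_le_nat[of "\<lambda>i. i < r \<and> (i, j) \<notin> ran \<sigma>" i' r] that by (auto simp: i_def)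
  have "(i', j) \<notin> ran \<sigma>" if "i' \<le> i" for i'
    using storing_up[OF \<sigma> _ that _ j] i by blast
  moreover have "(i', j) \<in> ran \<sigma>" if "i < i'" "i' < r" for i'
    using le[of i'] that by fastforce
  ultimately show ?thesis using i le[OF free] by blast
qed

text \<open>Pigeonhole: only loads with the same \<open>home\<close> enter an outer column, there
  are at most \<open>r\<close> of them, and \<open>x\<close> is not yet stored, so a cell is
  left.\<close>

lemma store_outer_column:
  assumes \<sigma>: "storing \<sigma>" "\<sigma> x = None" and x: "x \<in> {1..n}" "home x \<noteq> 0"
  shows "\<exists>bs. store_outcome \<sigma> x bs"
proof -
  note r = r_pos[OF x(1)]
  note h3 = home_ge_3[OF r x(2)]
  have "\<exists>i<r. (i, home x) \<notin> ran \<sigma>"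
  proof (rule ccontr)
    assume "\<not> ?thesis"
    then have "\<forall>i\<in>{..<r}. \<exists>y. \<sigma> y = Some (i, home x)" by (auto simp: ran_def)
    then obtain f where f: "\<And>i. i < r \<Longrightarrow> \<sigma> (f i) = Some (i, home x)" by (metis lessThan_iff)
    have "home (f i) = home x" if "i < r" for i
      using storing_fits[OF \<sigma>(1) f[OF that]] h3 by (auto simp: fits_def split: if_splits)
    moreover have "f i \<noteq> x" if "i < r" for i using f[OF that] \<sigma>(2) by auto
    ultimately have "f ` {..<r} \<subseteq> {y. home y = home x} - {x}" by auto
    moreover have "inj_on f {..<r}" using f by (intro inj_onI) (metis Pair_inject lessThan_iff option.inject)
    ultimately have "card {..<r} \<le> card ({y. home y = home x} - {x})"
      using card_home(1)[OF r, of "home x"] x(2) by (intro card_inj_on_le[of f]) auto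
    moreover have "card ({y. home y = home x} - {x}) < r"
      using card_home[OF r, of "home x"] x(2) r by (subst card_Diff_singleton) auto
    ultimately show False by simp
  qed
  then obtain i0 where i0: "i0 < r" "(i0, home x) \<notin> ran \<sigma>" by blast
  have "home x \<noteq> 1" using h3 by simp
  then obtain i where i: "i < r" "\<forall>i'\<le>i. (i', home x) \<notin> ran \<sigma>"
    "\<forall>i'>i. i' < r \<longrightarrow> (i', home x) \<in> ran \<sigma>"
    using deepest_free_row[OF \<sigma>(1) _ i0] by blast
  have "accessible r c \<sigma> (i, home x)"
    using i(1,2) home_less[OF x(1)] by (intro accessible_own_column) auto
  moreover have "fits (insert (i, home x) (ran \<sigma>)) x i (home x)"
    using i(1) x h3 home_eq_0[of x] by (auto simp: fits_def)
  moreover have "back_filled (insert (i, home x) (ran \<sigma>))"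
    using i(3) h3 \<sigma>(1) by (auto simp: storing_def back_filled_def)
  ultimately have "store_outcome \<sigma> x [Store x (i, home x)]"
    using single_store[OF \<sigma>, of i "home x"] i(2) h3 home_less[OF x(1)] by simp
  then show ?thesis by blast
qed

text \<open>While the exact cell of \<open>x > 1\<close> is free, \<open>back_filled\<close> keeps
  its neighbour in column 0 free, and with it all of column 0 in front. Load 1 enters
  \<open>(0, 1)\<close> directly.\<close>

lemma store_exact:
  assumes \<sigma>: "storing \<sigma>" "\<sigma> x = None" and x: "x \<in> {1..n}" "x \<le> k" and free: "(x - 1, 1) \<notin> ran \<sigma>"
  shows "\<exists>bs. store_outcome \<sigma> x bs"
proof -
  have lt: "x - 1 < r" using x k_le_r by auto
  have "accessible r c \<sigma> (x - 1, 1)"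
  proof (cases "x = 1")
    case True
    then show ?thesis using c_ge lt by (intro accessible_own_column) auto
  next
    case False
    then have "(x - 1, 0) \<notin> ran \<sigma>"
      using \<sigma>(1) free x unfolding storing_def back_filled_def by fastforce
    then have "(i', 0) \<notin> ran \<sigma>" if "i' \<le> x - 1" for i'
      using storing_up[OF \<sigma>(1) _ that lt] by simp
    then show ?thesis using lt c_ge by (intro accessible_side_column[where j' = 0]) auto
  qed
  moreover have "fits (insert (x - 1, 1) (ran \<sigma>)) x (x - 1) 1"
    using x lt by (auto simp: fits_def home_def)
  moreover have "back_filled (insert (x - 1, 1) (ran \<sigma>))"
    using \<sigma>(1) by (auto simp: storing_def back_filled_def)
  ultimately have "store_outcome \<sigma> x [Store x (x - 1, 1)]"
    using single_store[OF \<sigma> free] c_ge by simp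
  then show ?thesis by blast
qed

lemma central_cell: "storing \<sigma> \<Longrightarrow> \<sigma> y = Some (i, j) \<Longrightarrow> j \<le> 2 \<Longrightarrow> home y = 0"
  using storing_fits[of \<sigma> y i j] home_ge_3[of y] r_pos[of y]
  by (auto simp: fits_def split: if_splits)

text \<open>If columns 0 and 2 were full, back-filling would also fill rows 1 to
  \<open>k - 1\<close> of column 1, giving \<open>2 * r + k - 1\<close> stored loads with
  \<open>home\<close> 0. For \<open>k > 0\<close> neither \<open>x\<close> nor load 1, which fits
  only in \<open>(0, 1)\<close>, is among them, so at most \<open>2 * r + k - 2\<close> candidates
  exist. For \<open>k = 0\<close> excluding \<open>x\<close> suffices.\<close>

lemma central_cells_not_full:
  assumes \<sigma>: "storing \<sigma>" "\<sigma> x = None" and x: "x \<in> {1..n}" "home x = 0" "x = 1 \<Longrightarrow> k = 0"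
    and full: "\<forall>i<r. (i, 0) \<in> ran \<sigma>" "\<forall>i<r. (i, 2) \<in> ran \<sigma>"
  shows False
proof -
  note r = r_pos[OF x(1)]
  define X where "X = {..<r} \<times> {0} \<union> {..<r} \<times> {2} \<union> {1..<k} \<times> {1 :: nat}"
  have "X \<subseteq> ran \<sigma>"
    using full r \<sigma>(1) by (fastforce simp: X_def storing_def back_filled_def)
  then have "\<forall>p\<in>X. \<exists>y. \<sigma> y = Some p" by (auto simp: ran_def)
  then obtain f where f: "\<And>p. p \<in> X \<Longrightarrow> \<sigma> (f p) = Some p" by metis
  have "f ` X \<subseteq> {Suc (min 1 k)..k + 2 * r} - {x}"
  proof
    fix y assume "y \<in> f ` X"
    then obtain i j where p: "(i, j) \<in> X" "y = f (i, j)" by auto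
    then have y: "\<sigma> y = Some (i, j)" using f by blast
    have "j \<le> 2" "\<not> (i = 0 \<and> j = 1)" using p(1) by (auto simp: X_def)
    then have "home y = 0" "1 \<le> y" "1 \<le> k \<longrightarrow> y \<noteq> 1" "y \<noteq> x"
      using central_cell[OF \<sigma>(1) y] storing_fits[OF \<sigma>(1) y] y \<sigma>(2) by (auto simp: fits_def)
    then show "y \<in> {Suc (min 1 k)..k + 2 * r} - {x}" by (auto simp: home_eq_0 min_def)
  qed
  moreover have "inj_on f X" using f by (intro inj_onI) (metis option.inject)
  ultimately have "card X \<le> card ({Suc (min 1 k)..k + 2 * r} - {x})"
    by (intro card_inj_on_le[of f]) auto
  moreover have "x \<in> {Suc (min 1 k)..k + 2 * r}"
    using x home_eq_0[of x] by (cases "x = 1") (auto simp: min_def)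
  then have "card ({Suc (min 1 k)..k + 2 * r} - {x}) = k + 2 * r - min 1 k - 1"
    by (subst card_Diff_singleton) auto
  moreover have "card X = r + r + (k - 1)"
    unfolding X_def by (subst card_Un_disjoint; auto simp: card_cartesian_product)+
  ultimately show False using r by (cases "k = 0") (auto simp: min_def)
qed

text \<open>The cells are tried in the fill order described at \<open>back_filled\<close>, the spare
  last. A load \<open>x \<le> k\<close> comes here only when \<open>(x - 1, 0)\<close> is occupied,
  so whatever cell it gets lies strictly in front of its exact row.\<close>

lemma store_filler:
  assumes \<sigma>: "storing \<sigma>" "\<sigma> x = None" and x: "x \<in> {1..n}" "home x = 0"
    and displaced: "x \<le> k \<Longrightarrow> 2 \<le> x \<and> (x - 1, 0) \<in> ran \<sigma>"
  shows "\<exists>bs. store_outcome \<sigma> x bs"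
proof -
  note r = r_pos[OF x(1)]
  have bk: "back_filled (ran \<sigma>)" using \<sigma>(1) by (simp add: storing_def)
  then have bf: "\<And>i i' j. (i, j) \<in> ran \<sigma> \<Longrightarrow> i < i' \<Longrightarrow> i' < r \<Longrightarrow> j \<noteq> 1 \<Longrightarrow> (i', j) \<in> ran \<sigma>"
    "\<And>i i'. (i, 0) \<in> ran \<sigma> \<Longrightarrow> i \<le> i' \<Longrightarrow> 0 < i' \<Longrightarrow> i' < k \<Longrightarrow> (i', 1) \<in> ran \<sigma>"
    "\<And>i i'. (i, 0) \<in> ran \<sigma> \<Longrightarrow> 0 < i' \<Longrightarrow> i' < r \<Longrightarrow> (i', 2) \<in> ran \<sigma>"
    unfolding back_filled_def by blast+
  show ?thesis
  proof (cases "\<exists>i0>0. i0 < r \<and> (i0, 2) \<notin> ran \<sigma>")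
    case True
    then obtain i0 where i0: "0 < i0" "i0 < r" "(i0, 2) \<notin> ran \<sigma>" by blast
    then obtain i where i: "i0 \<le> i" "i < r" "\<forall>i'\<le>i. (i', 2) \<notin> ran \<sigma>"
      "\<forall>i'>i. i' < r \<longrightarrow> (i', 2) \<in> ran \<sigma>"
      using deepest_free_row[OF \<sigma>(1), of 2 i0] by auto
    \<comment> \<open>For \<open>x \<le> k\<close> the occupied cell \<open>(x - 1, 0)\<close> would
      force column 2 to be full behind its front cell.\<close>
    have "k < x" using displaced bf(3)[of "x - 1" i0] i0 by fastforce
    then have "fits (insert (i, 2) (ran \<sigma>)) x i 2" using i(2) x by (auto simp: fits_def)
    moreover have "back_filled (insert (i, 2) (ran \<sigma>))"
      using i(4) bk by (auto simp: back_filled_def)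
    moreover have "accessible r c \<sigma> (i, 2)"
      using i(2,3) c_ge by (intro accessible_own_column) auto
    ultimately have "store_outcome \<sigma> x [Store x (i, 2)]"
      using single_store[OF \<sigma>, of i 2] i(1,3) i0(1) c_ge by simp
    then show ?thesis by blast
  next
    case False
    then have full2: "\<forall>i'>0. i' < r \<longrightarrow> (i', 2) \<in> ran \<sigma>" by blast
    show ?thesis
    proof (cases "\<exists>i0<r. (i0, 0) \<notin> ran \<sigma>")
      case True
      then obtain i0 where i0: "i0 < r" "(i0, 0) \<notin> ran \<sigma>" by blast
      then obtain i where i: "i < r" "\<forall>i'\<le>i. (i', 0) \<notin> ran \<sigma>"
        "\<forall>i'>i. i' < r \<longrightarrow> (i', 0) \<in> ran \<sigma>"
        using deepest_free_row[OF \<sigma>(1) _ i0] by auto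
      have deep: "i + 2 \<le> x" if "x \<le> k"
      proof -
        have "\<not> x - 1 \<le> i" using displaced[OF that] i(2) by blast
        then show ?thesis by simp
      qed
      have full1: "(i', 1) \<in> ran \<sigma>" if "i < i'" "i' < k" for i'
        using bf(2)[of "Suc i" i'] i(3) that k_le_r by auto
      show ?thesis
      proof (cases "0 < i \<and> i < k \<and> (i, 1) \<notin> ran \<sigma>")
        case True
        then have "Suc i < x" using deep by (cases "x \<le> k") auto
        then have "fits (insert (i, 1) (ran \<sigma>)) x i 1"
          using i(1,3) x True deep full1 full2 by (auto simp: fits_def)
        moreover have "back_filled (insert (i, 1) (ran \<sigma>))"
          using bk by (auto simp: back_filled_def)
        moreover have "accessible r c \<sigma> (i, 1)"
          using i(1,2) c_ge by (intro accessible_side_column[where j' = 0]) auto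
        ultimately have "store_outcome \<sigma> x [Store x (i, 1)]"
          using single_store[OF \<sigma>, of i 1] True c_ge by simp
        then show ?thesis by blast
      next
        case False
        have "fits (insert (i, 0) (ran \<sigma>)) x i 0"
          using i(1) x deep by (auto simp: fits_def)
        moreover have "back_filled (insert (i, 0) (ran \<sigma>))"
          unfolding back_filled_def
        proof (intro conjI allI impI)
          fix a a' j assume "(a, j) \<in> insert (i, 0) (ran \<sigma>)" "a < a'" "a' < r" "j \<noteq> 1"
          then show "(a', j) \<in> insert (i, 0) (ran \<sigma>)" using i(3) bf(1) by blast
        next
          fix a a' assume *: "(a, 0) \<in> insert (i, 0) (ran \<sigma>)" "a \<le> a'" "0 < a'" "a' < k"
          show "(a', 1) \<in> insert (i, 0) (ran \<sigma>)"
          proof (cases "a = i")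
            case True
            then show ?thesis using * False full1[of a'] by (cases "a' = i") auto
          next
            case False
            then show ?thesis using * bf(2) by blast
          qed
        next
          fix a a' assume "(a, 0) \<in> insert (i, 0) (ran \<sigma>)" "0 < a'" "a' < r"
          then show "(a', 2) \<in> insert (i, 0) (ran \<sigma>)" using full2 by blast
        qed
        moreover have "accessible r c \<sigma> (i, 0)"
          using i(1,2) c_ge by (intro accessible_own_column) auto
        ultimately have "store_outcome \<sigma> x [Store x (i, 0)]"
          using single_store[OF \<sigma>, of i 0] i(2) c_ge by simp
        then show ?thesis by blast
      qed
    next
      case full0: False
      \<comment> \<open>The spare cannot be taken: then columns 0 and 2 would both be full, against
        the count above.\<close>
      have free: "(0, 2) \<notin> ran \<sigma>"
      proof
        assume "(0, 2) \<in> ran \<sigma>"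
        then have "\<forall>i<r. (i, 2) \<in> ran \<sigma>" using full2 by (metis gr0I)
        moreover have "x = 1 \<Longrightarrow> k = 0" using displaced by (cases "x \<le> k") auto
        ultimately show False using central_cells_not_full[OF \<sigma> x] full0 by blast
      qed
      have "fits (insert (0, 2) (ran \<sigma>)) x 0 2"
        using x r displaced by (auto simp: fits_def)
      moreover have "back_filled (insert (0, 2) (ran \<sigma>))"
        using bk full2 by (auto simp: back_filled_def)
      moreover have "accessible r c \<sigma> (0, 2)"
        using r c_ge by (intro accessible_own_column) auto
      moreover have "\<forall>y. 1 < y \<longrightarrow> y \<le> k \<longrightarrow> (y - 1, 0) \<in> ran \<sigma>"
        using full0 k_le_r by auto
      ultimately have "store_outcome \<sigma> x [Store x (0, 2)]"
        using single_store[OF \<sigma> free] c_ge by simp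
      then show ?thesis by blast
    qed
  qed
qed

text \<open>During storage column 0 serves as the aisle: the load steps sideways into it, moves
  along it and, for \<open>j = 1\<close>, steps back into column 1.\<close>

lemma relocate_along_aisle:
  assumes v: "\<sigma> v = Some (a, 1)" and b: "(b, j) \<notin> ran \<sigma>" "j = 0 \<or> j = 1" and lt: "a < r" "b < r"
    and aisle: "\<forall>i\<le>max a b. (i, 0) \<notin> ran \<sigma>"
  shows "legal r c \<sigma> (Relocate v (b, j))"
proof -
  let ?S = "insert (a, 1) (empty_cells r c \<sigma>)"
  have cells: "(i, 0) \<in> ?S" if "i \<le> max a b" for i
    using that aisle lt c_ge by (auto simp: empty_cells_def grid_def)
  have bS: "(b, j) \<in> ?S" using b lt c_ge by (auto simp: empty_cells_def grid_def)
  obtain p where "path_in ?S (a, 0) p (b, 0)"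
    using column_path_up[of a b 0 ?S] column_path_down[of b a 0 ?S] cells
    by (cases "a \<le> b") (auto simp: max_def)
  then have p: "path_in ?S (a, 1) ((a, 1) # p) (b, 0)"
    by (rule path_in_Cons) auto
  have "\<exists>p. path_in ?S (a, 1) p (b, j)"
  proof (cases "j = 0")
    case False
    then have "path_in ?S (a, 1) (((a, 1) # p) @ [(b, j)]) (b, j)"
      using b(2) bS by (intro path_in_snoc[OF p]) auto
    then show ?thesis by blast
  qed (use p in blast)
  moreover have "accessible r c \<sigma> (a, 1)"
    using aisle lt c_ge by (intro accessible_side_column[where j' = 0]) auto
  moreover have "accessible r c \<sigma> (b, j)"
  proof (cases "j = 0")
    case True
    then show ?thesis using aisle lt c_ge by (intro accessible_own_column) auto
  next
    case False
    then show ?thesis using b(2) aisle lt c_ge by (intro accessible_side_column[where j' = 0]) auto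
  qed
  ultimately show ?thesis
    using v b lt c_ge by (auto simp: empty_cells_def grid_def)
qed

text \<open>Describes the net effect of the exchange, whatever detour \<open>v\<close> takes. As a
  foreign load in column 1, \<open>v\<close> certifies through \<open>fits\<close> that columns 0
  and 1 are full behind row \<open>i\<close> and column 2 is full up to its front cell. So
  \<open>(i, 0)\<close> is next in the fill order, and row \<open>i\<close> becomes settled.\<close>

lemma settle_displaced:
  assumes \<sigma>: "storing \<sigma>" "\<sigma> (Suc i) = None" and i: "Suc i \<in> {1..n}" "i < k"
    and v: "\<sigma> v = Some (i, 1)" and free: "(i, 0) \<notin> ran \<sigma>"
  defines "\<sigma>' \<equiv> \<sigma>(v \<mapsto> (i, 0), Suc i \<mapsto> (i, 1))"
  shows "storing \<sigma>'" "dom \<sigma>' = insert (Suc i) (dom \<sigma>)" "ran \<sigma>' = insert (i, 0) (ran \<sigma>)"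
    "insert i (settled \<sigma>) \<subseteq> settled \<sigma>'" "i \<notin> settled \<sigma>"
proof -
  have "v \<noteq> Suc i" using v \<sigma>(2) by auto
  then have vf: "0 < i" "Suc i < v" "i < r" "v \<in> {1..n}" "home v = 0" "v \<le> k \<longrightarrow> i + 2 \<le> v"
    and full: "\<forall>i'>i. (i' < r \<longrightarrow> (i', 0) \<in> ran \<sigma>) \<and> (i' < k \<longrightarrow> (i', 1) \<in> ran \<sigma>)"
      "\<forall>i'>0. i' < r \<longrightarrow> (i', 2) \<in> ran \<sigma>"
    using storing_fits[OF \<sigma>(1) v] central_cell[OF \<sigma>(1) v] unfolding fits_def by auto
  have in_ran: "(i, 1) \<in> ran \<sigma>" using v by (auto simp: ran_def)
  have inj: "inj_on \<sigma> (dom \<sigma>)" using \<sigma>(1) by (simp add: storing_def)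
  have ran1: "ran (\<sigma>(v \<mapsto> (i, 0))) = ran \<sigma> - {(i, 1)} \<union> {(i, 0)}"
    using v inj free by (intro ran_map_upd_Some) auto
  show ran': "ran \<sigma>' = insert (i, 0) (ran \<sigma>)"
    unfolding \<sigma>'_def using in_ran \<sigma>(2) \<open>v \<noteq> Suc i\<close> ran1 by (subst ran_map_upd) auto
  show dom': "dom \<sigma>' = insert (Suc i) (dom \<sigma>)"
    using v by (auto simp: \<sigma>'_def)
  have "inj_on \<sigma>' (dom \<sigma>')"
  proof (rule inj_onI)
    fix y z assume "y \<in> dom \<sigma>'" "z \<in> dom \<sigma>'" "\<sigma>' y = \<sigma>' z"
    then show "y = z"
      using storing_inj[OF \<sigma>(1) v] storing_inj[OF \<sigma>(1)] free
      by (auto simp: \<sigma>'_def ran_def split: if_splits)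
  qed
  moreover have "back_filled (ran \<sigma>')"
    using \<sigma>(1) full in_ran unfolding ran' storing_def back_filled_def
    by (auto simp: le_less)
  moreover have "fits (ran \<sigma>') y a b" if "\<sigma>' y = Some (a, b)" for y a b
  proof (cases "y = v \<or> y = Suc i")
    case True
    then show ?thesis using that vf i \<open>v \<noteq> Suc i\<close> by (auto simp: \<sigma>'_def fits_def home_eq_0)
  next
    case False
    then have "fits (ran \<sigma>) y a b" using that by (intro storing_fits[OF \<sigma>(1)]) (simp add: \<sigma>'_def)
    then show ?thesis by (rule fits_mono) (auto simp: ran')
  qed
  moreover have "(y - 1, 0) \<in> ran \<sigma>'" if "(0, 2) \<in> ran \<sigma>'" "1 < y" "y \<le> k" "\<sigma>' y = None" for y
  proof -
    have "(0, 2) \<in> ran \<sigma>" "\<sigma> y = None" using that ran' by (auto simp: \<sigma>'_def split: if_splits)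
    then show ?thesis using \<sigma>(1) that(2,3) unfolding storing_def ran' by blast
  qed
  ultimately show "storing \<sigma>'" unfolding storing_def by blast
  show "i \<notin> settled \<sigma>" using \<sigma>(2) by (simp add: settled_def)
  have "z \<in> settled \<sigma>'" if "z \<in> settled \<sigma>" for z
  proof -
    have "Suc z \<noteq> v" "Suc z \<noteq> Suc i" using that v \<sigma>(2) \<open>v \<noteq> Suc i\<close> by (auto simp: settled_def)
    then show ?thesis using that unfolding settled_def ran' by (auto simp: \<sigma>'_def)
  qed
  moreover have "i \<in> settled \<sigma>'" using vf i unfolding settled_def ran' by (auto simp: \<sigma>'_def)
  ultimately show "insert i (settled \<sigma>) \<subseteq> settled \<sigma>'" by blast
qed

text \<open>The exact cell of \<open>x\<close> is held by a foreign load \<open>v\<close>, which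
  should end in the free neighbour in column 0. Once \<open>v\<close> is there it closes the aisle
  at that row, so \<open>x\<close> needs either a way around \<open>v\<close> or a place where
  \<open>v\<close> can wait.\<close>

lemma store_displaced:
  assumes \<sigma>: "storing \<sigma>" "\<sigma> x = None" and x: "x \<in> {1..n}" "x \<le> k"
    and taken: "(x - 1, 1) \<in> ran \<sigma>" and free: "(x - 1, 0) \<notin> ran \<sigma>"
  shows "\<exists>bs. store_outcome \<sigma> x bs"
proof -
  obtain i where xi: "x = Suc i" using x by (cases x) auto
  with taken obtain v where v: "\<sigma> v = Some (i, 1)" by (auto simp: ran_def)
  have "v \<noteq> x" using v \<sigma>(2) by auto
  have i: "Suc i \<in> {1..n}" "i < k" "\<sigma> (Suc i) = None" "(i, 0) \<notin> ran \<sigma>" using x \<sigma>(2) free xi by auto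
  note settle = settle_displaced[OF \<sigma>(1) i(3) i(1,2) v i(4)]
  let ?\<sigma>' = "\<sigma>(v \<mapsto> (i, 0), Suc i \<mapsto> (i, 1))"
  have vf: "0 < i" "i < r"
    and full: "\<forall>i'>i. (i' < r \<longrightarrow> (i', 0) \<in> ran \<sigma>) \<and> (i' < k \<longrightarrow> (i', 1) \<in> ran \<sigma>)"
      "\<forall>i'>0. i' < r \<longrightarrow> (i', 2) \<in> ran \<sigma>"
    using storing_fits[OF \<sigma>(1) v] \<open>v \<noteq> x\<close> xi unfolding fits_def by auto
  have aisle: "\<forall>i'\<le>i. (i', 0) \<notin> ran \<sigma>"
    using storing_up[OF \<sigma>(1) i(4) _ vf(2)] by simp
  have inj: "inj_on \<sigma> (dom \<sigma>)" using \<sigma>(1) by (simp add: storing_def)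
  \<comment> \<open>A foreign load at \<open>(j, 1)\<close> would require \<open>(i, 0)\<close>,
    which is farther back, to be occupied.\<close>
  have exact: "\<sigma> (Suc j) = Some (j, 1)" if j: "j < i" "(j, 1) \<in> ran \<sigma>" for j
  proof -
    obtain w where w: "\<sigma> w = Some (j, 1)" using j(2) unfolding ran_def by blast
    then have "w = Suc j"
      using storing_fits[OF \<sigma>(1) w] i(4) j(1) vf(2) unfolding fits_def by auto
    then show ?thesis using w by simp
  qed
  \<comment> \<open>If \<open>(i - 1, 1)\<close> is free, \<open>v\<close> moves to
    \<open>(i, 0)\<close> first and \<open>x\<close> goes around it. If only a farther cell
    \<open>(j, 1)\<close> is free, \<open>v\<close> waits there while \<open>x\<close> is stored.
    Otherwise all rows in front hold their exact loads, and \<open>x\<close> takes the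
    spare.\<close>
  consider (adjacent) "(i - 1, 1) \<notin> ran \<sigma>"
    | (hole) j where "j < i - 1" "(j, 1) \<notin> ran \<sigma>" "(i - 1, 1) \<in> ran \<sigma>"
    | (none) "\<forall>j<i. (j, 1) \<in> ran \<sigma>"
  proof (cases "\<forall>j<i. (j, 1) \<in> ran \<sigma>")
    case False
    then obtain j where "j < i" "(j, 1) \<notin> ran \<sigma>" by blast
    moreover from this have "j = i - 1 \<or> j < i - 1" by arith
    ultimately show ?thesis using that(1,2) by blast
  qed (rule that(3))
  then show ?thesis
  proof cases
    case adjacent
    let ?bs = "[Relocate v (i, 0), Store x (i, 1)]"
    let ?\<sigma>1 = "\<sigma>(v \<mapsto> (i, 0))"
    have "legal r c \<sigma> (Relocate v (i, 0))"
      using relocate_along_aisle[OF v i(4) _ vf(2) vf(2)] aisle by simp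
    moreover have "ran ?\<sigma>1 = ran \<sigma> - {(i, 1)} \<union> {(i, 0)}"
      using v inj i(4) by (intro ran_map_upd_Some) auto
    then have ran1: "(i, 1) \<notin> ran ?\<sigma>1" "(i - 1, 1) \<notin> ran ?\<sigma>1"
      "\<forall>i'\<le>i - 1. (i', 0) \<notin> ran ?\<sigma>1"
      using adjacent aisle vf(1) by auto
    have "accessible r c ?\<sigma>1 (i, 1)"
    proof -
      let ?S = "insert (i, 1) (empty_cells r c ?\<sigma>1)"
      have "\<exists>p. path_in ?S (0, 0) p (i - 1, 0)"
        using ran1(3) vf(2) c_ge by (intro column_path_up) (auto simp: empty_cells_def grid_def)
      then obtain p where "path_in ?S (0, 0) p (i - 1, 0)" by blast
      then have "path_in ?S (0, 0) (p @ [(i - 1, 1)]) (i - 1, 1)"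
        using ran1(2) vf c_ge by (intro path_in_snoc) (auto simp: empty_cells_def grid_def)
      then have "path_in ?S (0, 0) ((p @ [(i - 1, 1)]) @ [(i, 1)]) (i, 1)"
        using vf(1) by (intro path_in_snoc) auto
      moreover have "(0, 0) \<in> front_row r c" using vf(2) c_ge by (auto simp: front_row_def grid_def)
      ultimately show ?thesis unfolding accessible_def by blast
    qed
    then have "legal r c ?\<sigma>1 (Store x (i, 1))"
      using ran1(1) \<sigma>(2) \<open>v \<noteq> x\<close> vf(2) c_ge by (auto simp: empty_cells_def grid_def)
    ultimately have "legal_run r c \<sigma> ?bs" by (simp del: legal.simps)
    moreover have "fold perform ?bs \<sigma> = ?\<sigma>'" using xi by simp
    moreover have "Suc (card (settled \<sigma>)) \<le> card (settled ?\<sigma>')"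
      using card_mono[OF finite_settled settle(4)] settle(5) finite_settled by simp
    ultimately have "store_outcome \<sigma> x ?bs"
      using settle(1,2) xi unfolding store_outcome_def by simp
    then show ?thesis by blast
  next
    \<comment> \<open>The two relocations are charged to the rows \<open>i\<close> and \<open>i - 1\<close>, which both become settled.\<close>
    case hole
    let ?bs = "[Relocate v (j, 1), Store x (i, 1), Relocate v (i, 0)]"
    let ?\<sigma>1 = "\<sigma>(v \<mapsto> (j, 1))"
    let ?\<sigma>2 = "?\<sigma>1(x \<mapsto> (i, 1))"
    have ji: "j < i" using hole(1) by simp
    have "legal r c \<sigma> (Relocate v (j, 1))"
      using relocate_along_aisle[OF v hole(2) _ vf(2)] aisle ji vf(2) by simp
    moreover have ran1: "ran ?\<sigma>1 = ran \<sigma> - {(i, 1)} \<union> {(j, 1)}"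
      using v inj hole(2) by (intro ran_map_upd_Some) auto
    have "accessible r c ?\<sigma>1 (i, 1)"
      using ran1 aisle vf(2) c_ge by (intro accessible_side_column[where j' = 0]) auto
    then have "legal r c ?\<sigma>1 (Store x (i, 1))"
      using ran1 ji \<sigma>(2) \<open>v \<noteq> x\<close> vf(2) c_ge by (auto simp: empty_cells_def grid_def)
    moreover have ran2: "ran ?\<sigma>2 = insert (i, 1) (ran ?\<sigma>1)"
      using \<sigma>(2) \<open>v \<noteq> x\<close> by (intro ran_map_upd) simp
    have "legal r c ?\<sigma>2 (Relocate v (i, 0))"
      using \<open>v \<noteq> x\<close> ji vf(2) aisle ran1 ran2 by (intro relocate_along_aisle[of _ _ j]) auto
    ultimately have "legal_run r c \<sigma> ?bs" by (simp del: legal.simps)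
    moreover have "fold perform ?bs \<sigma> = ?\<sigma>'" using xi \<open>v \<noteq> x\<close> by (auto simp: fun_eq_iff)
    moreover have "Suc (Suc (card (settled \<sigma>))) \<le> card (settled ?\<sigma>')"
    proof -
      have "\<sigma> i = Some (i - 1, 1)" using exact[of "i - 1"] hole(3) vf(1) by simp
      then have "i - 1 \<in> settled ?\<sigma>'"
        using hole(1) i(2) \<open>v \<noteq> x\<close> v unfolding settled_def settle(3) by auto
      \<comment> \<open>Row \<open>i - 1\<close> did not count before, since
        \<open>(i - 1, 0)\<close> and \<open>(i, 0)\<close> were both free; the latter now holds
        \<open>v\<close>.\<close>
      moreover have "i - 1 \<notin> settled \<sigma>"
        using aisle hole(1) by (auto simp: settled_def)
      ultimately have "insert (i - 1) (insert i (settled \<sigma>)) \<subseteq> settled ?\<sigma>'"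
        "card (insert (i - 1) (insert i (settled \<sigma>))) = Suc (Suc (card (settled \<sigma>)))"
        using settle(4,5) finite_settled[of \<sigma>] vf(1) by auto
      then show ?thesis using card_mono[OF finite_settled, of "insert (i - 1) (insert i (settled \<sigma>))"]
        by metis
    qed
    ultimately have "store_outcome \<sigma> x ?bs"
      using settle(1,2) xi unfolding store_outcome_def by simp
    then show ?thesis by blast
  next
    case none
    have spare: "(0, 2) \<notin> ran \<sigma>"
    proof
      assume "(0, 2) \<in> ran \<sigma>"
      then have "1 < x \<longrightarrow> (x - 1, 0) \<in> ran \<sigma>" using \<sigma> x(2) unfolding storing_def by blast
      then show False using free xi vf(1) by simp
    qed
    have "fits (insert (0, 2) (ran \<sigma>)) x 0 2"
      using x xi vf by (auto simp: fits_def home_eq_0)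
    moreover have "back_filled (insert (0, 2) (ran \<sigma>))"
      using \<sigma>(1) full(2) by (auto simp: storing_def back_filled_def)
    moreover have "accessible r c \<sigma> (0, 2)"
      using vf c_ge by (intro accessible_own_column) auto
    \<comment> \<open>Using the spare is safe: in front of row \<open>i\<close> every exact cell
      already holds its own load, and behind row \<open>i\<close> column 0 is full because of
      \<open>v\<close>.\<close>
    moreover have "(y - 1, 0) \<in> ran \<sigma>" if y: "1 < y" "y \<le> k" "y \<noteq> x" "\<sigma> y = None" for y
    proof -
      have "\<not> y - 1 < i"
      proof
        assume "y - 1 < i"
        then have "\<sigma> (Suc (y - 1)) = Some (y - 1, 1)" using none by (intro exact) auto
        then show False using y(1,4) by simp
      qed
      then have "i < y - 1" using y(1,3) xi by auto
      then show ?thesis using full(1) y(1,2) k_le_r by auto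
    qed
    ultimately have "store_outcome \<sigma> x [Store x (0, 2)]"
      using single_store[OF \<sigma> spare] c_ge by simp
    then show ?thesis by blast
  qed
qed

lemma store_step:
  assumes "storing \<sigma>" "\<sigma> x = None" "x \<in> {1..n}"
  shows "\<exists>bs. store_outcome \<sigma> x bs"
proof (cases "x \<le> k")
  case True
  then have "home x = 0" by (simp add: home_eq_0)
  consider "(x - 1, 1) \<notin> ran \<sigma>" | "(x - 1, 1) \<in> ran \<sigma>" "(x - 1, 0) \<notin> ran \<sigma>"
    | "(x - 1, 1) \<in> ran \<sigma>" "(x - 1, 0) \<in> ran \<sigma>" by blast
  then show ?thesis
  proof cases
    case 3
    then obtain v where v: "\<sigma> v = Some (x - 1, 1)" by (auto simp: ran_def)
    then have "v \<noteq> x" using assms(2) by auto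
    then have "2 \<le> x" using storing_fits[OF assms(1) v] assms(3) by (auto simp: fits_def)
    then show ?thesis using store_filler[OF assms \<open>home x = 0\<close>] 3 by blast
  qed (use store_exact[OF assms True] store_displaced[OF assms True] in blast)+
next
  case False
  then show ?thesis
    using store_filler[OF assms] store_outer_column[OF assms] by (cases "home x = 0") auto
qed

section \<open>The retrieval phase\<close>

text \<open>In the retrieval phase column 1 is the aisle: before load \<open>y\<close> leaves, its first \<open>y - 1\<close> rows
  are empty.\<close>

definition emptying :: "load \<Rightarrow> config \<Rightarrow> bool" where
  "emptying y \<sigma> \<longleftrightarrow> inj_on \<sigma> (dom \<sigma>) \<and> dom \<sigma> = {y..n} \<and>
     (\<forall>x i j. \<sigma> x = Some (i, j) \<longrightarrow> i < r \<and> (if home x = 0 then j \<le> 2 else j = home x) \<and>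
        (x \<le> k \<longrightarrow> i = x - 1 \<and> j = 1 \<or> i + 2 \<le> x) \<and> (j = 1 \<longrightarrow> y \<le> Suc i \<and> i < k))"

text \<open>Potential of the retrieval phase: each relocation is paid for by one of these loads as
  it departs.\<close>

definition misplaced :: "load \<Rightarrow> config \<Rightarrow> load set" where
  "misplaced y \<sigma> = {x. y \<le> x \<and> x \<le> k \<and> \<sigma> x \<noteq> Some (x - 1, 1)}"

lemma finite_misplaced: "finite (misplaced y \<sigma>)"
  by (rule finite_subset[of _ "{..k}"]) (auto simp: misplaced_def)

lemma emptyingD:
  assumes "emptying y \<sigma>" "\<sigma> x = Some (i, j)"
  shows "i < r" "home x = 0 \<Longrightarrow> j \<le> 2" "home x \<noteq> 0 \<Longrightarrow> j = home x"
    "x \<le> k \<Longrightarrow> i = x - 1 \<and> j = 1 \<or> i + 2 \<le> x" "j = 1 \<Longrightarrow> y \<le> Suc i \<and> i < k" "y \<le> x" "x \<le> n"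
  using assms unfolding emptying_def by (auto split: if_splits)

lemma emptying_inj:
  "emptying y \<sigma> \<Longrightarrow> \<sigma> x = Some p \<Longrightarrow> \<sigma> z = Some p \<Longrightarrow> x = z"
  unfolding emptying_def by (metis domI inj_onD)

lemma emptying_main_column: "emptying y \<sigma> \<Longrightarrow> Suc i < y \<Longrightarrow> (i, 1) \<notin> ran \<sigma>"
  using emptyingD(5) by (fastforce simp: ran_def)

text \<open>There are three ways out. A load in its exact cell leaves along column 1; one in column
  0 or 2 steps into column 1, which is empty up to its row; one in an outer column steps to the
  left, where monotonicity of \<open>home\<close> shows that all loads have departed.\<close>

lemma emptying_accessible:
  assumes \<sigma>: "emptying y \<sigma>" and y: "1 \<le> y" "\<sigma> y = Some (i, j)"
  shows "accessible r c \<sigma> (i, j)"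
proof -
  note D = emptyingD[OF \<sigma> y(2)]
  have r: "0 < r" using D(1) by simp
  consider "i = y - 1" "j = 1" | "j = 0 \<or> j = 2" "\<forall>i'\<le>i. (i', 1) \<notin> ran \<sigma>" | "k < y" "home y \<noteq> 0"
  proof (cases "y \<le> k")
    case True
    then have "home y = 0" by (simp add: home_eq_0)
    then show ?thesis
      using that True D emptying_main_column[OF \<sigma>] by (cases "i = y - 1 \<and> j = 1"; cases "j = 1") force+
  next
    case False
    have "(i', 1) \<notin> ran \<sigma>" for i'
      using emptyingD(5)[OF \<sigma>, of _ i' 1] False by (fastforce simp: ran_def)
    then show ?thesis
      using that False D(2) D(5) by (cases "home y = 0"; cases "j = 1") force+
  qed
  then show ?thesis
  proof cases
    case 1
    then show ?thesis using D(1) c_ge emptying_main_column[OF \<sigma>] by (intro accessible_own_column) auto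
  next
    case 2
    then show ?thesis using D(1) c_ge by (intro accessible_side_column[where j' = 1]) auto
  next
    case 3
    then have j: "j = home y" "3 \<le> j" using D(3) home_ge_3[OF r] by auto
    have "(i', j - 1) \<notin> ran \<sigma>" for i'
    proof
      assume "(i', j - 1) \<in> ran \<sigma>"
      then obtain z where z: "\<sigma> z = Some (i', j - 1)" by (auto simp: ran_def)
      then have "home y \<le> home z" using emptyingD(6)[OF \<sigma> z] by (intro home_mono)
      then show False using emptyingD(2,3)[OF \<sigma> z] j by (cases "home z = 0") auto
    qed
    moreover have "j < c" using home_less[of y] D(6,7) y(1) j(1) by simp
    ultimately show ?thesis using D(1) j(2) by (intro accessible_side_column[where j' = "j - 1"]) auto
  qed
qed

text \<open>Only a load \<open>y \<le> k\<close> outside its exact cell can leave a blocker in row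
  \<open>y - 1\<close> of column 1. That blocker moves forward into the cell \<open>y\<close> has
  just vacated, at the expense of \<open>y\<close>.\<close>

lemma retrieve_all:
  assumes "emptying y \<sigma>" "1 \<le> y" "y \<le> Suc n"
  shows "\<exists>rs. legal_run r c \<sigma> rs \<and> stored_loads rs = [] \<and> retrieved_loads rs = [y..<Suc n] \<and>
    length rs \<le> Suc n - y + card (misplaced y \<sigma>)"
  using assms
proof (induction "Suc n - y" arbitrary: y \<sigma>)
  case 0
  then have "y = Suc n" by simp
  then show ?case by (intro exI[of _ "[]"]) simp
next
  case (Suc m)
  then have "y \<le> n" by simp
  have \<sigma>: "emptying y \<sigma>" by fact
  have "m = Suc n - Suc y" using Suc.hyps(2) by simp
  then have IH: "\<exists>rs. legal_run r c \<sigma>' rs \<and> stored_loads rs = [] \<and>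
      retrieved_loads rs = [Suc y..<Suc n] \<and> length rs \<le> Suc n - Suc y + card (misplaced (Suc y) \<sigma>')"
    if "emptying (Suc y) \<sigma>'" for \<sigma>'
    using that \<open>y \<le> n\<close> by (intro Suc.hyps(1)) simp_all
  have "y \<in> dom \<sigma>" using \<sigma> \<open>y \<le> n\<close> by (simp add: emptying_def)
  then obtain i j where y: "\<sigma> y = Some (i, j)" by auto
  note D = emptyingD[OF \<sigma> y]
  have inj: "inj_on \<sigma> (dom \<sigma>)" and dom: "dom \<sigma> = {y..n}" using \<sigma> by (auto simp: emptying_def)
  define \<sigma>1 where "\<sigma>1 = \<sigma>(y := None)"
  have \<sigma>1: "\<sigma>1 x = Some p \<longleftrightarrow> x \<noteq> y \<and> \<sigma> x = Some p" for x p by (simp add: \<sigma>1_def)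
  have inj1: "inj_on \<sigma>1 (dom \<sigma>1)" unfolding \<sigma>1_def using inj
    by (auto simp: inj_on_def)
  have dom1: "dom \<sigma>1 = {Suc y..n}" unfolding \<sigma>1_def using dom by auto
  have ret: "legal r c \<sigma> (Retrieve y)" using emptying_accessible[OF \<sigma> Suc.prems(2) y] y by simp
  have upt: "[y..<Suc n] = y # [Suc y..<Suc n]" using \<open>y \<le> n\<close> by (simp add: upt_conv_Cons)
  show ?case
  proof (cases "y \<le> k \<and> \<sigma> y \<noteq> Some (y - 1, 1) \<and> (y - 1, 1) \<in> ran \<sigma>")
    case False
    have clear: "Suc y \<le> Suc a" if "\<sigma>1 x = Some (a, 1)" for x a
    proof -
      have x: "x \<noteq> y" "\<sigma> x = Some (a, 1)" using that by (auto simp: \<sigma>1)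
      have "y \<le> Suc a" "a < k" using emptyingD(5)[OF \<sigma> x(2)] by auto
      moreover have "a \<noteq> y - 1"
      proof
        assume "a = y - 1"
        then have "(y - 1, 1) \<in> ran \<sigma>" "y \<le> k" using x(2) \<open>a < k\<close> by (auto simp: ran_def)
        then have "\<sigma> y = Some (a, 1)" using False \<open>a = y - 1\<close> by blast
        then show False using emptying_inj[OF \<sigma> _ x(2)] x(1) by blast
      qed
      ultimately show ?thesis by simp
    qed
    have "emptying (Suc y) \<sigma>1"
      unfolding emptying_def
    proof (intro conjI allI impI inj1 dom1)
      fix x a b assume x: "\<sigma>1 x = Some (a, b)"
      then have x': "\<sigma> x = Some (a, b)" by (simp add: \<sigma>1)
      note E = emptyingD[OF \<sigma> x']
      show "a < r" by (rule E)
      show "if home x = 0 then b \<le> 2 else b = home x" using E(2,3) by simp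
      show "a = x - 1 \<and> b = 1 \<or> a + 2 \<le> x" if "x \<le> k" using E(4) that .
      show "Suc y \<le> Suc a" if "b = 1" using clear x that by simp
      show "a < k" if "b = 1" using E(5) that by simp
    qed
    from IH[OF this] obtain rs where rs: "legal_run r c \<sigma>1 rs" "stored_loads rs = []"
      "retrieved_loads rs = [Suc y..<Suc n]" "length rs \<le> Suc n - Suc y + card (misplaced (Suc y) \<sigma>1)"
      by blast
    have "misplaced (Suc y) \<sigma>1 \<subseteq> misplaced y \<sigma>" by (auto simp: misplaced_def \<sigma>1_def)
    then have "card (misplaced (Suc y) \<sigma>1) \<le> card (misplaced y \<sigma>)" by (intro card_mono finite_misplaced)
    then have "length (Retrieve y # rs) \<le> Suc n - y + card (misplaced y \<sigma>)"
      using rs(4) \<open>y \<le> n\<close> by simp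
    then show ?thesis
      using rs ret upt by (intro exI[of _ "Retrieve y # rs"]) (simp add: \<sigma>1_def)
  next
    case True
    then have "i + 2 \<le> y" using D(4) y by auto
    then have j: "j = 0 \<or> j = 2"
      using D(2,5) True home_eq_0[of y] by (cases "j = 1") auto
    from True obtain v where v: "\<sigma> v = Some (y - 1, 1)" unfolding ran_def by blast
    note E = emptyingD[OF \<sigma> v]
    have "v \<noteq> y" using True v by blast
    have hv: "home v = 0" using E(3) home_ge_3[of v] D(1) by (cases "home v = 0") auto
    have ran1: "ran \<sigma>1 = ran \<sigma> - {(i, j)}"
    proof (intro set_eqI iffI)
      fix p assume "p \<in> ran \<sigma>1"
      then obtain x where "x \<noteq> y" "\<sigma> x = Some p" by (auto simp: ran_def \<sigma>1)
      then show "p \<in> ran \<sigma> - {(i, j)}" using emptying_inj[OF \<sigma> y, of x] by (auto simp: ran_def)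
    next
      fix p assume "p \<in> ran \<sigma> - {(i, j)}"
      then obtain x where "\<sigma> x = Some p" "p \<noteq> (i, j)" by (auto simp: ran_def)
      then have "\<sigma>1 x = Some p" using y by (auto simp: \<sigma>1)
      then show "p \<in> ran \<sigma>1" by (rule ranI)
    qed
    have free1: "(a, 1) \<notin> ran \<sigma>1" if "a < y - 1" for a
      using emptying_main_column[OF \<sigma>, of a] that ran1 by auto
    define \<sigma>2 where "\<sigma>2 = \<sigma>1(v \<mapsto> (i, j))"
    have v1: "\<sigma>1 v = Some (y - 1, 1)" using v \<open>v \<noteq> y\<close> by (simp add: \<sigma>1)
    have "(i, j) \<in> grid r c" using D(1) j c_ge by (auto simp: grid_def)
    then have ij: "(i, j) \<in> empty_cells r c \<sigma>1" by (simp add: empty_cells_def ran1)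
    have legal2: "legal r c \<sigma>1 (Relocate v (i, j))"
    proof -
      let ?S = "insert (y - 1, 1) (empty_cells r c \<sigma>1)"
      have "\<exists>p. path_in ?S (y - 1, 1) p (i, 1)"
        using \<open>i + 2 \<le> y\<close> free1 E(1) c_ge
        by (intro column_path_down) (auto simp: empty_cells_def grid_def)
      then obtain p where p: "path_in ?S (y - 1, 1) p (i, 1)" by blast
      have "path_in ?S (y - 1, 1) (p @ [(i, j)]) (i, j)"
        by (rule path_in_snoc[OF p]) (use ij j in auto)
      moreover have "accessible r c \<sigma>1 (y - 1, 1)"
        using E(1) c_ge free1 by (intro accessible_own_column) auto
      moreover have "accessible r c \<sigma>1 (i, j)"
        using D(1) c_ge free1 j \<open>i + 2 \<le> y\<close> by (intro accessible_side_column[where j' = 1]) auto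
      ultimately show ?thesis using v1 ij by auto
    qed
    have "emptying (Suc y) \<sigma>2"
      unfolding emptying_def
    proof (intro conjI allI impI)
      have "(i, j) \<notin> ran \<sigma>1" using ran1 by simp
      then show "inj_on \<sigma>2 (dom \<sigma>2)" using inj1 by (auto simp: \<sigma>2_def inj_on_def ran_def)
      show "dom \<sigma>2 = {Suc y..n}" using dom1 E(6,7) \<open>v \<noteq> y\<close> by (auto simp: \<sigma>2_def)
      fix x a b assume x: "\<sigma>2 x = Some (a, b)"
      have "a < r \<and> (if home x = 0 then b \<le> 2 else b = home x) \<and>
        (x \<le> k \<longrightarrow> a = x - 1 \<and> b = 1 \<or> a + 2 \<le> x) \<and> (b = 1 \<longrightarrow> Suc y \<le> Suc a \<and> a < k)"
      proof (cases "x = v")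
        case True
        then show ?thesis using x hv D(1) j \<open>i + 2 \<le> y\<close> E(6) by (auto simp: \<sigma>2_def)
      next
        case False
        then have x': "\<sigma> x = Some (a, b)" using x by (simp add: \<sigma>2_def \<sigma>1)
        have "(a, b) \<noteq> (y - 1, 1)" using emptying_inj[OF \<sigma> v] x' False by metis
        then show ?thesis using emptyingD[OF \<sigma> x'] by auto
      qed
      then show "a < r" "if home x = 0 then b \<le> 2 else b = home x"
        "x \<le> k \<Longrightarrow> a = x - 1 \<and> b = 1 \<or> a + 2 \<le> x" "b = 1 \<Longrightarrow> Suc y \<le> Suc a" "b = 1 \<Longrightarrow> a < k"
        by auto
    qed
    from IH[OF this] obtain rs where rs: "legal_run r c \<sigma>2 rs" "stored_loads rs = []"
      "retrieved_loads rs = [Suc y..<Suc n]" "length rs \<le> Suc n - Suc y + card (misplaced (Suc y) \<sigma>2)"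
      by blast
    \<comment> \<open>The blocker \<open>v > y\<close> was not in its own exact cell, so moving it
      adds nothing to the potential, while \<open>y\<close> drops out.\<close>
    have "misplaced (Suc y) \<sigma>2 \<subseteq> misplaced y \<sigma> - {y}"
      using v E(6) \<open>v \<noteq> y\<close> Suc.prems(2) by (auto simp: misplaced_def \<sigma>2_def \<sigma>1_def split: if_splits)
    then have "card (misplaced (Suc y) \<sigma>2) \<le> card (misplaced y \<sigma> - {y})"
      by (intro card_mono finite_Diff finite_misplaced)
    moreover have "y \<in> misplaced y \<sigma>" using True by (simp add: misplaced_def)
    then have "Suc (card (misplaced y \<sigma> - {y})) = card (misplaced y \<sigma>)"
      by (intro card_Suc_Diff1 finite_misplaced)
    ultimately have "length (Retrieve y # Relocate v (i, j) # rs) \<le> Suc n - y + card (misplaced y \<sigma>)"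
      using rs(4) \<open>y \<le> n\<close> by simp
    moreover have "legal_run r c \<sigma> (Retrieve y # Relocate v (i, j) # rs)"
      using ret legal2 rs(1)
      by (simp add: \<sigma>2_def \<sigma>1_def del: legal.simps)
    ultimately show ?thesis
      using rs(2,3) upt by (intro exI[of _ "Retrieve y # Relocate v (i, j) # rs"]) simp
  qed
qed

section \<open>Counting the relocations of both phases\<close>

lemma storing_imp_emptying:
  assumes "storing \<sigma>" "dom \<sigma> = {1..n}"
  shows "emptying 1 \<sigma>"
  using assms unfolding storing_def emptying_def fits_def by auto

text \<open>Settled rows belong to loads in their exact cells, so no load is counted twice. Load 1
  is never counted: row 0 is excluded from \<open>settled\<close>, and no row in front of row 0
  exists in which load 1 could be misplaced.\<close>

lemma card_misplaced_settled:
  assumes \<sigma>: "storing \<sigma>" "dom \<sigma> = {1..n}"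
  shows "card (misplaced 1 \<sigma>) + card (settled \<sigma>) \<le> k - 1"
proof -
  have "k \<le> n" by (simp add: k_def)
  have "misplaced 1 \<sigma> \<subseteq> {2..k}"
  proof
    fix x assume x: "x \<in> misplaced 1 \<sigma>"
    have "x \<noteq> 1"
    proof
      assume "x = 1"
      then have "1 \<in> dom \<sigma>" using x \<sigma>(2) \<open>k \<le> n\<close> by (auto simp: misplaced_def)
      then obtain i j where "\<sigma> 1 = Some (i, j)" by auto
      with storing_fits[OF \<sigma>(1) this] x \<open>x = 1\<close> show False by (auto simp: misplaced_def fits_def)
    qed
    then show "x \<in> {2..k}" using x by (auto simp: misplaced_def)
  qed
  moreover have "Suc ` settled \<sigma> \<subseteq> {2..k}" "misplaced 1 \<sigma> \<inter> Suc ` settled \<sigma> = {}"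
    by (auto simp: settled_def misplaced_def)
  ultimately have "card (misplaced 1 \<sigma> \<union> Suc ` settled \<sigma>) \<le> card {2..k}"
    by (intro card_mono) auto
  moreover have "card (misplaced 1 \<sigma> \<union> Suc ` settled \<sigma>) = card (misplaced 1 \<sigma>) + card (Suc ` settled \<sigma>)"
    using \<open>misplaced 1 \<sigma> \<inter> Suc ` settled \<sigma> = {}\<close>
    by (intro card_Un_disjoint finite_misplaced finite_imageI finite_settled)
  moreover have "card (Suc ` settled \<sigma>) = card (settled \<sigma>)" by (intro card_image) simp
  ultimately show ?thesis by simp
qed

text \<open>For \<open>k = Suc m\<close> the first inequality is \<open>(m - 1)^2 \<ge> 0\<close>
  over the integers; the shape condition \<open>r \<le> c\<close> then turns \<open>k * k\<close>
  into \<open>k * c\<close>.\<close>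

lemma four_relocations_le: "4 * (k - 1) \<le> n"
proof (cases k)
  case (Suc m)
  have "4 * m \<le> Suc m * Suc m"
  proof -
    have "0 \<le> (int m - 1) ^ 2" by simp
    then have "4 * int m \<le> int (Suc m * Suc m)" by (simp add: power2_eq_square algebra_simps)
    then show ?thesis by linarith
  qed
  also have "\<dots> = k * k" by (simp add: Suc)
  also have "\<dots> \<le> k * c" using k_le_r r_le_c by (intro mult_le_mono2) simp
  also have "\<dots> \<le> n" by (simp add: k_def)
  finally show ?thesis by (simp add: Suc)
qed simp

text \<open>Storage exceeds \<open>n\<close> actions by at most the number of settled rows,
  retrieval by at most the number of misplaced loads. Together this is at most \<open>k - 1\<close>,
  hence at most \<open>n div 4\<close>.\<close>

lemma strategy_exists:
  "\<exists>S. \<forall>A. distinct A \<and> set A = {1..n} \<longrightarrow>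
    serves_online r c 1 S A [1..<Suc n] \<and> length (online_actions 1 S A) \<le> 2 * n + n div 4"
proof (rule online_strategy_from_steps)
  let ?\<sigma> = "\<lambda>as. fold perform as Map.empty"
  let ?good = "\<lambda>xs as. legal_run r c Map.empty as \<and> storing (?\<sigma> as) \<and> dom (?\<sigma> as) = set xs \<and>
    length as \<le> length xs + card (settled (?\<sigma> as))"
  show "?good [] []" by (simp add: storing_def back_filled_def)
  show "\<exists>bs. stored_loads bs = [x] \<and> retrieved_loads bs = [] \<and> ?good (xs @ [x]) (as @ bs)"
    if good: "?good xs as" and x: "distinct (xs @ [x])" "set (xs @ [x]) \<subseteq> {1..n}" for xs as x
  proof -
    have "?\<sigma> as x = None" using good x(1) by (auto simp: domIff)
    with good x(2) obtain bs where "store_outcome (?\<sigma> as) x bs" using store_step[of "?\<sigma> as" x] by auto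
    then show ?thesis
      using good unfolding store_outcome_def by (intro exI[of _ bs]) (simp add: legal_run_append)
  qed
  show "\<exists>rs. stored_loads rs = [] \<and> retrieved_loads rs = [1..<Suc n] \<and>
      legal_run r c Map.empty (as @ rs) \<and> length (as @ rs) \<le> 2 * n + n div 4"
    if good: "?good A as" and A: "distinct A" "set A = {1..n}" for A as
  proof -
    have "length A = n" using A distinct_card[of A] by simp
    have *: "storing (?\<sigma> as)" "dom (?\<sigma> as) = {1..n}" using good A(2) by auto
    obtain rs where rs: "legal_run r c (?\<sigma> as) rs" "stored_loads rs = []" "retrieved_loads rs = [1..<Suc n]"
      "length rs \<le> n + card (misplaced 1 (?\<sigma> as))"
      using retrieve_all[OF storing_imp_emptying[OF *]] by auto
    then have "length (as @ rs) \<le> 2 * n + (k - 1)"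
      using good card_misplaced_settled[OF *] \<open>length A = n\<close> by simp
    then have "length (as @ rs) \<le> 2 * n + n div 4" using four_relocations_le by linarith
    then show ?thesis using rs good by (intro exI[of _ rs]) (simp add: legal_run_append)
  qed
qed

end

section \<open>The remaining cases\<close>

lemma accessible_front: "0 < r \<Longrightarrow> j < c \<Longrightarrow> accessible r c \<sigma> (0, j)"
  by (intro accessible_own_column) auto

lemma legal_run_retrieve_front:
  assumes "distinct ys" "\<forall>y\<in>set ys. \<exists>j<c. \<sigma> y = Some (0, j)" "0 < r \<or> ys = []"
  shows "legal_run r c \<sigma> (map Retrieve ys)"
  using assms
proof (induction ys arbitrary: \<sigma>)
  case (Cons y ys)
  then have "legal_run r c (\<sigma>(y := None)) (map Retrieve ys)" by (intro Cons.IH) auto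
  then show ?case using Cons.prems accessible_front by auto
qed simp

lemma stored_retrieved_map_Retrieve [simp]:
  "stored_loads (map Retrieve ys) = []" "retrieved_loads (map Retrieve ys) = ys"
  by (induction ys) simp_all

text \<open>Each load gets a front cell of its own, \<open>(0, x - 1)\<close>, which is always
  accessible, so no relocation occurs.\<close>

lemma strategy_front_row:
  assumes "n \<le> c" "n \<le> r * c"
  shows "\<exists>S. \<forall>A. distinct A \<and> set A = {1..n} \<longrightarrow>
    serves_online r c 1 S A [1..<Suc n] \<and> length (online_actions 1 S A) \<le> 2 * n + n div 4"
proof (rule online_strategy_from_steps)
  let ?\<sigma> = "\<lambda>as. fold perform as Map.empty"
  let ?good = "\<lambda>xs as. legal_run r c Map.empty as \<and> length as = length xs \<and>
    ?\<sigma> as = (\<lambda>x. if x \<in> set xs then Some (0, x - 1) else None)"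
  have r: "0 < r" if "x \<in> {1..n}" for x using that assms by (auto intro: Nat.gr0I)
  show "?good [] []" by simp
  show "\<exists>bs. stored_loads bs = [x] \<and> retrieved_loads bs = [] \<and> ?good (xs @ [x]) (as @ bs)"
    if good: "?good xs as" and x: "distinct (xs @ [x])" "set (xs @ [x]) \<subseteq> {1..n}" for xs as x
  proof -
    have free: "(0, x - 1) \<notin> ran (?\<sigma> as)"
    proof
      assume "(0, x - 1) \<in> ran (?\<sigma> as)"
      then obtain z where "z \<in> set xs" "z - 1 = x - 1" using good by (auto simp: ran_def split: if_splits)
      moreover from this have "1 \<le> z" "1 \<le> x" using x(2) by auto
      ultimately have "x \<in> set xs" by (metis le_add_diff_inverse)
      then show False using x(1) by simp
    qed
    moreover have "?\<sigma> as x = None" "x - 1 < c" "0 < r" using good x r[of x] assms(1) by auto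
    ultimately have "legal r c (?\<sigma> as) (Store x (0, x - 1))"
      using accessible_front by (auto simp: empty_cells_def grid_def)
    moreover have "?\<sigma> (as @ [Store x (0, x - 1)]) = (\<lambda>z. if z \<in> set (xs @ [x]) then Some (0, z - 1) else None)"
      using good by (auto simp: fun_eq_iff)
    ultimately show ?thesis
      using good by (intro exI[of _ "[Store x (0, x - 1)]"]) (simp add: legal_run_append del: legal.simps)
  qed
  show "\<exists>rs. stored_loads rs = [] \<and> retrieved_loads rs = [1..<Suc n] \<and>
      legal_run r c Map.empty (as @ rs) \<and> length (as @ rs) \<le> 2 * n + n div 4"
    if good: "?good A as" and A: "distinct A" "set A = {1..n}" for A as
  proof (intro exI conjI)
    have "length A = n" using A distinct_card[of A] by simp
    then show "length (as @ map Retrieve [1..<Suc n]) \<le> 2 * n + n div 4" using good by simp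
    have "legal_run r c (?\<sigma> as) (map Retrieve [1..<Suc n])"
      using good A assms(1) r[of 1] by (intro legal_run_retrieve_front) auto
    then show "legal_run r c Map.empty (as @ map Retrieve [1..<Suc n])"
      using good by (simp add: legal_run_append)
  qed (simp_all only: stored_retrieved_map_Retrieve)
qed

section \<open>The 2 by 2 storage area\<close>

lemma accessible_2_2:
  assumes "j < 2" "(0, j) \<notin> ran \<sigma> \<or> (0, 1 - j) \<notin> ran \<sigma> \<and> (1, 1 - j) \<notin> ran \<sigma>"
  shows "accessible 2 2 \<sigma> (1, j)"
  using assms(2)
proof
  assume "(0, j) \<notin> ran \<sigma>"
  then show ?thesis using assms(1) by (intro accessible_own_column) auto
next
  assume "(0, 1 - j) \<notin> ran \<sigma> \<and> (1, 1 - j) \<notin> ran \<sigma>"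
  then have "(i, 1 - j) \<notin> ran \<sigma>" if "i \<le> 1" for i using that by (cases i) auto
  then show ?thesis using assms(1) by (intro accessible_side_column[where j' = "1 - j"]) auto
qed

text \<open>For three or four loads in a \<open>2 \<times> 2\<close> storage area, load 1 goes to \<open>(0, 0)\<close>
  and the others to the remaining cells in the order of their arrival. One relocation is needed only if load 2 ends up in \<open>(1, 1)\<close> and is
  blocked by the load in \<open>(0, 1)\<close>.\<close>

definition slots_2_2 :: "cell list" where
  "slots_2_2 = [(1, 0), (1, 1), (0, 1)]"

definition config_2_2 :: "load list \<Rightarrow> config" where
  "config_2_2 xs = (\<lambda>x. if x = 1 then (if 1 \<in> set xs then Some (0, 0) else None)
     else map_of (zip (filter (\<lambda>x. x \<noteq> 1) xs) slots_2_2) x)"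

text \<open>The slot order keeps every slot reachable when its turn comes: \<open>(1, 0)\<close>
  through column 1 even if load 1 already occupies \<open>(0, 0)\<close>, then \<open>(1, 1)\<close>
  through the still empty \<open>(0, 1)\<close>, which is itself a front cell.\<close>

lemma store_2_2:
  assumes x: "distinct (xs @ [x])" "set (xs @ [x]) \<subseteq> {1..4}"
  shows "\<exists>p. legal 2 2 (config_2_2 xs) (Store x p) \<and> (config_2_2 xs)(x \<mapsto> p) = config_2_2 (xs @ [x])"
proof (cases "x = 1")
  case True
  have "(0, 0) \<notin> ran (config_2_2 xs)"
    using True x by (auto simp: config_2_2_def slots_2_2_def ran_def dest!: map_of_SomeD set_zip_rightD)
  then have "legal 2 2 (config_2_2 xs) (Store x (0, 0))"
    using True x accessible_front[of 2 0 2] by (auto simp: empty_cells_def grid_def config_2_2_def)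
  moreover have "(config_2_2 xs)(x \<mapsto> (0, 0)) = config_2_2 (xs @ [x])"
    using True by (auto simp: config_2_2_def fun_eq_iff)
  ultimately show ?thesis by blast
next
  case False
  define bs where "bs = filter (\<lambda>x. x \<noteq> 1) xs"
  have bs: "distinct bs" "x \<notin> set bs" "set bs \<subseteq> {2..4}" "x \<in> {2..4}"
    using x False by (auto simp: bs_def)
  have "length bs < 3"
  proof -
    have "card (insert x (set bs)) \<le> card {2..4::nat}" using bs by (intro card_mono) auto
    then show ?thesis using bs distinct_card[OF bs(1)] by simp
  qed
  then have "bs = [] \<or> (\<exists>a. bs = [a]) \<or> (\<exists>a b. bs = [a, b])"
    by (cases bs; cases "tl bs"; cases "tl (tl bs)") auto
  moreover have conf: "config_2_2 xs z = (if z = 1 then (if 1 \<in> set xs then Some (0, 0) else None)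
     else map_of (zip bs slots_2_2) z)" for z
    by (simp add: config_2_2_def bs_def)
  have conf': "config_2_2 (xs @ [x]) z = (if z = 1 then (if 1 \<in> set xs then Some (0, 0) else None)
     else map_of (zip (bs @ [x]) slots_2_2) z)" for z
    using False by (simp add: config_2_2_def bs_def)
  ultimately consider "bs = []" | a where "bs = [a]" | a b where "bs = [a, b]" by blast
  then show ?thesis
  proof cases
    case 1
    then have "legal 2 2 (config_2_2 xs) (Store x (1, 0))"
      using False accessible_2_2[of 0 "config_2_2 xs"]
      by (auto simp: conf ran_def empty_cells_def grid_def split: if_splits)
    moreover have "(config_2_2 xs)(x \<mapsto> (1, 0)) = config_2_2 (xs @ [x])"
      using False 1 by (auto simp: conf conf' fun_eq_iff slots_2_2_def)
    ultimately show ?thesis by blast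
  next
    case 2
    then have "legal 2 2 (config_2_2 xs) (Store x (1, 1))"
      using False bs(2) accessible_2_2[of 1 "config_2_2 xs"]
      by (auto simp: conf ran_def empty_cells_def grid_def slots_2_2_def split: if_splits)
    moreover have "(config_2_2 xs)(x \<mapsto> (1, 1)) = config_2_2 (xs @ [x])"
      using False bs(2) 2 by (auto simp: conf conf' fun_eq_iff slots_2_2_def)
    ultimately show ?thesis by blast
  next
    case 3
    then have "legal 2 2 (config_2_2 xs) (Store x (0, 1))"
      using False bs(2) accessible_front[of 2 1 2 "config_2_2 xs"]
      by (auto simp: conf ran_def empty_cells_def grid_def slots_2_2_def split: if_splits)
    moreover have "(config_2_2 xs)(x \<mapsto> (0, 1)) = config_2_2 (xs @ [x])"
      using False bs(2) 3 by (auto simp: conf conf' fun_eq_iff slots_2_2_def)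
    ultimately show ?thesis by blast
  qed
qed

text \<open>\<open>(0, 1)\<close> stays empty and load 1 leaves \<open>(0, 0)\<close> first, so
  neither back cell is blocked afterwards.\<close>

lemma retrieve_2_2_three:
  assumes "{a, b} = {2, 3 :: nat}"
  shows "legal_run 2 2 [1 \<mapsto> (0, 0), a \<mapsto> (1, 0), b \<mapsto> (1, 1)] (map Retrieve [1, 2, 3])"
proof -
  have "a = 2 \<and> b = 3 \<or> a = 3 \<and> b = 2" using assms by (auto simp: doubleton_eq_iff)
  then show ?thesis
    using accessible_front[of 2 _ 2] accessible_2_2
    by (auto simp: ran_def)
qed


lemma retrieve_2_2_four:
  assumes "{a, b, d} = {2, 3, 4 :: nat}"
  shows "\<exists>rs. legal_run 2 2 [1 \<mapsto> (0, 0), a \<mapsto> (1, 0), b \<mapsto> (1, 1), d \<mapsto> (0, 1)] rs \<and>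
    stored_loads rs = [] \<and> retrieved_loads rs = [1, 2, 3, 4] \<and> length rs \<le> 5"
proof -
  let ?\<sigma> = "[1 \<mapsto> (0, 0), a \<mapsto> (1, 0), b \<mapsto> (1, 1), d \<mapsto> (0, 1)] :: config"
  have "distinct [a, b, d]" using assms by (intro card_distinct) simp
  moreover have mem: "a \<in> {2, 3, 4}" "b \<in> {2, 3, 4}" "d \<in> {2, 3, 4}" using assms by blast+
  ultimately have cases: "a = 2 \<and> b = 3 \<and> d = 4 \<or> a = 2 \<and> b = 4 \<and> d = 3 \<or> a = 3 \<and> b = 4 \<and> d = 2 \<or>
      a = 4 \<and> b = 3 \<and> d = 2 \<or> b = 2 \<and> a = 3 \<and> d = 4 \<or> b = 2 \<and> a = 4 \<and> d = 3"
    by auto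
  show ?thesis
  proof (cases "b = 2")
    case False
    \<comment> \<open>Load 2 is in \<open>(1, 0)\<close> or \<open>(0, 1)\<close>; its departure
      after load 1 opens a way to \<open>(1, 1)\<close>.\<close>
    have "legal_run 2 2 ?\<sigma> (map Retrieve [1, 2, 3, 4])"
      using cases False
      by (elim disjE conjE; hypsubst_thin)
        (auto simp: ran_def split: if_splits intro!: accessible_front accessible_2_2[unfolded One_nat_def])
    then show ?thesis by (intro exI[of _ "map Retrieve [1, 2, 3, 4]"]) simp
  next
    case True
    then have "a = 3 \<and> d = 4 \<or> a = 4 \<and> d = 3" using cases by auto
    \<comment> \<open>Moving the blocker \<open>d\<close> into the cell of load 1 frees
      \<open>(0, 1)\<close>. Once load 2 has gone, the load in \<open>(1, 0)\<close> can leave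
      through column 1.\<close>
    with True have "legal_run 2 2 ?\<sigma> [Retrieve 1, Relocate d (0, 0), Retrieve 2, Retrieve 3, Retrieve 4]"
      by (auto simp: ran_def empty_cells_def grid_def path_in_def split: if_splits
        intro!: accessible_front accessible_2_2[unfolded One_nat_def] exI[of _ "[(0, Suc 0), (0, 0)]"])
    then show ?thesis
      by (intro exI[of _ "[Retrieve 1, Relocate d (0, 0), Retrieve 2, Retrieve 3, Retrieve 4]"]) simp
  qed
qed

lemma strategy_2_2:
  assumes "n = 3 \<or> n = 4"
  shows "\<exists>S. \<forall>A. distinct A \<and> set A = {1..n} \<longrightarrow>
    serves_online 2 2 1 S A [1..<Suc n] \<and> length (online_actions 1 S A) \<le> 2 * n + n div 4"
proof (rule online_strategy_from_steps)
  let ?\<sigma> = "\<lambda>as. fold perform as Map.empty"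
  let ?good = "\<lambda>xs as. legal_run 2 2 Map.empty as \<and> length as = length xs \<and> ?\<sigma> as = config_2_2 xs"
  show "?good [] []" by (simp add: config_2_2_def fun_eq_iff)
  show "\<exists>bs. stored_loads bs = [x] \<and> retrieved_loads bs = [] \<and> ?good (xs @ [x]) (as @ bs)"
    if good: "?good xs as" and x: "distinct (xs @ [x])" "set (xs @ [x]) \<subseteq> {1..n}" for xs as x
  proof -
    have "set (xs @ [x]) \<subseteq> {1..4}" using x(2) assms by auto
    from store_2_2[OF x(1) this] obtain p where "legal 2 2 (config_2_2 xs) (Store x p)"
      "(config_2_2 xs)(x \<mapsto> p) = config_2_2 (xs @ [x])" by blast
    then show ?thesis
      using good by (intro exI[of _ "[Store x p]"]) (simp add: legal_run_append del: legal.simps)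
  qed
  show "\<exists>rs. stored_loads rs = [] \<and> retrieved_loads rs = [1..<Suc n] \<and>
      legal_run 2 2 Map.empty (as @ rs) \<and> length (as @ rs) \<le> 2 * n + n div 4"
    if good: "?good A as" and A: "distinct A" "set A = {1..n}" for A as
  proof -
    define bs where "bs = filter (\<lambda>x. x \<noteq> 1) A"
    have bs: "distinct bs" "set bs = {2..n}" using A by (auto simp: bs_def)
    then have "length bs = n - 1" using distinct_card[of bs] by simp
    have bs1: "1 \<notin> set bs" using bs(2) by simp
    have len: "length A = n" using A distinct_card[of A] by simp
    have "config_2_2 A z = (if z = 1 then Some (0, 0) else map_of (zip bs slots_2_2) z)" for z
      using A assms by (auto simp: config_2_2_def bs_def)
    then have conf: "?\<sigma> as z = (if z = 1 then Some (0, 0) else map_of (zip bs slots_2_2) z)" for z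
      using good by simp
    have "\<exists>rs. legal_run 2 2 (?\<sigma> as) rs \<and> stored_loads rs = [] \<and> retrieved_loads rs = [1..<Suc n] \<and>
        length rs \<le> n + n div 4"
      using assms
    proof
      assume n: "n = 3"
      obtain a b where ab: "bs = [a, b]"
        using \<open>length bs = n - 1\<close> n by (auto simp: numeral_eq_Suc length_Suc_conv)
      have "{2..3 :: nat} = {2, 3}" by auto
      then have set: "{a, b} = {2, 3}" using bs(2) by (simp add: ab n)
      have "?\<sigma> as = [1 \<mapsto> (0, 0), a \<mapsto> (1, 0), b \<mapsto> (1, 1)]"
        using bs(1) bs1 ab by (auto simp: conf slots_2_2_def fun_eq_iff)
      then have "legal_run 2 2 (?\<sigma> as) (map Retrieve [1, 2, 3])" using retrieve_2_2_three[OF set] by simp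
      then show ?thesis using n by (intro exI conjI) (assumption, simp_all add: upt_rec)
    next
      assume n: "n = 4"
      obtain a b d where abd: "bs = [a, b, d]"
        using \<open>length bs = n - 1\<close> n by (auto simp: numeral_eq_Suc length_Suc_conv)
      have "{2..4 :: nat} = {2, 3, 4}" by auto
      then have set: "{a, b, d} = {2, 3, 4}" using bs(2) by (simp add: abd n)
      have "?\<sigma> as = [1 \<mapsto> (0, 0), a \<mapsto> (1, 0), b \<mapsto> (1, 1), d \<mapsto> (0, 1)]"
        using bs(1) bs1 abd by (auto simp: conf slots_2_2_def fun_eq_iff)
      moreover have "[1..<Suc 4] = [1, 2, 3, 4]" by (simp add: upt_rec numeral_eq_Suc)
      ultimately show ?thesis using retrieve_2_2_four[OF set] by (simp add: n del: upt_Suc)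
    qed
    then obtain rs where "legal_run 2 2 (?\<sigma> as) rs" "stored_loads rs = []"
      "retrieved_loads rs = [1..<Suc n]" "length rs \<le> n + n div 4" by blast
    then show ?thesis using good len by (intro exI[of _ rs]) (simp add: legal_run_append)
  qed
qed

theorem mainTheorem6:
  fixes r c n :: nat
  assumes "r \<le> c" and "n \<le> r * c"
  shows "\<exists>S :: strategy. \<forall>A. distinct A \<and> set A = {1..n} \<longrightarrow>
           serves_online r c 1 S A [1..<Suc n] \<and>
           real (length (online_actions 1 S A)) \<le> 1.125 * real (min_actions r c A [1..<Suc n])"
proof -
  \<comment> \<open>With \<open>r \<le> c \<le> 2\<close> and more loads than columns, only the 2 by
    2 area with three or four loads remains.\<close>
  consider "n \<le> c" | "3 \<le> c" | "r = 2" "c = 2" "n = 3 \<or> n = 4"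
  proof (cases "n \<le> c \<or> 3 \<le> c")
    case False
    then have "1 < r" using assms(2) by (cases r; cases "r - 1") auto
    then have rc: "r = 2" "c = 2" using False assms(1) by auto
    then have "n = 3 \<or> n = 4" using False assms(2) by auto
    then show ?thesis using rc that(3) by blast
  qed (use that in auto)
  then obtain S where S: "\<And>A. distinct A \<and> set A = {1..n} \<Longrightarrow>
    serves_online r c 1 S A [1..<Suc n] \<and> length (online_actions 1 S A) \<le> 2 * n + n div 4"
  proof cases
    case 1
    then show ?thesis using strategy_front_row[OF _ assms(2)] that by blast
  next
    case 2
    then have "storage_area r c n" using assms by unfold_locales
    then show ?thesis using storage_area.strategy_exists that by blast
  next
    case 3
    then show ?thesis using strategy_2_2 that by blast
  qed
  show ?thesis
  proof (intro exI[of _ S] allI impI conjI)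
    fix A :: "load list" assume A: "distinct A \<and> set A = {1..n}"
    show "serves_online r c 1 S A [1..<Suc n]" using S[OF A] by blast
    then have "length A + length [1..<Suc n] \<le> min_actions r c A [1..<Suc n]"
      unfolding serves_online_def by (blast intro: min_actions_ge)
    moreover have "length A = n" using A distinct_card[of A] by simp
    ultimately have "2 * n \<le> min_actions r c A [1..<Suc n]" by (simp del: upt_Suc)
    \<comment> \<open>Here \<open>18 = 8 * (2 + 1/4)\<close>, so \<open>2 * n + n div 4\<close> is
      at most \<open>9/8\<close>, that is 1.125, times the lower bound \<open>2 * n\<close>.\<close>
    moreover have "8 * length (online_actions 1 S A) \<le> 18 * n" using S[OF A] by linarith
    ultimately have "8 * length (online_actions 1 S A) \<le> 9 * min_actions r c A [1..<Suc n]" by linarith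
    then have "real (8 * length (online_actions 1 S A)) \<le> real (9 * min_actions r c A [1..<Suc n])"
      by (simp only: of_nat_le_iff)
    then show "real (length (online_actions 1 S A)) \<le> 1.125 * real (min_actions r c A [1..<Suc n])"
      by (simp del: upt_Suc)
  qed
qed

end
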